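(* Let $X$ be either (a) a scaled Brownian motion $\sigma W$ with $\sigma>0$, or (b) the Ornstein--Uhlenbeck process $\mathrm{d}X_t=-\theta X_t\,\mathrm{d}t+\sigma\,\mathrm{d}W_t$ with $\theta,\sigma>0$; in either case $X_0=x_0$ and the target is the bridge law on $[0,T]$ conditioned on $X_T=x_T$. Let $C_{\mathrm{rej}}:(0,\infty)\to(0,\infty)$ be the expected-cost function of the bridge sampler used inside each Gibbs step, and assume there are constants $K,t_0>0$ with $C_{\mathrm{rej}}(t)\le Kt$ for all $0<t\le t_0$; in case (a) assume $C_{\mathrm{rej}}(t)=c_5t$ for all $t>0$, for some constant $c_5>0$. For $m\ge1$ let $\rho_{m,T}$ be the $\mathcal L^2$-convergence rate of the checkerboard (equivalently, the lexicographic) Gibbs sampler on the knot vector $\mathcal G$, let $\mathcal T(T,m)=-1/\log\rho_{m,T}$, and define $$C_{\mathrm{blocking}}(T,m):=\mathcal T(T,m)\cdot m\cdot C_{\mathrm{rej}}\!\left(\tfrac{2T}{m+1}\right).$$ Then for every $c_1>0$ and $\chi_1>0$, with $m(T)=\lceil c_1T^{1+\chi_1}\rceil$, $$C_{\mathrm{blocking}}(T,m(T))=\mathcal O\!\left(T^{3+2\chi_1}\right)\quad\text{as }T\to\infty$$ (in particular $\mathcal O(T^{3+\chi_2})$ for arbitrarily small $\chi_2>0$). In case (a) the same holds with $\chi_1=0$, i.e. with $m(T)=\lceil c_1T\rceil$ one has $C_{\mathrm{blocking}}(T,m(T))=\mathcal O(T^3)$.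
   Context: Knots: fix $m\ge1$, $\delta=\delta_{m,T}:=T/(m+1)$, anchors $k_i=i\delta$, $i=1,\dots,m$. The knot vector $\mathcal G=(X_{k_1},\dots,X_{k_m})$ conditioned on $(X_0,X_T)=(x_0,x_T)$ is a nondegenerate Gaussian vector in $\mathbb R^m$ with law $\pi$. Checkerboard Gibbs sweep: first update all odd-indexed coordinates of $\mathcal G$ jointly from their conditional law given the even-indexed ones, then all even-indexed coordinates from their conditional law given the odd-indexed ones. Lexicographic Gibbs sweep: update coordinate $1$ from its full conditional law given the others, then coordinate $2$, ..., then coordinate $m$. A sweep defines a Markov kernel $P$ with invariant law $\pi$. $\mathcal L^2$-convergence rate: the smallest $\rho$ such that for every $f\in L^2(\pi)$ and every $r>\rho$ there is $V_f>0$ with $\int\left[P^nf(x)-\pi(f)\right]^2\pi(\mathrm dx)\le V_f r^n$ for all $n$, where $P^nf(x)=\mathbb E[f(\mathcal G^{(n)})\mid\mathcal G^{(0)}=x]$. *)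

theory Defs
  imports "HOL-Probability.Probability" "HOL-Library.Landau_Symbols"
begin

text \<open>Transition density p(t,a,b) of X_t at b given X_0 = a.
  (a) scaled Brownian motion sigma W: N(a, sigma^2 t).
  (b) Ornstein-Uhlenbeck dX = -theta X dt + sigma dW:
      N(a e^{-theta t}, sigma^2 (1 - e^{-2 theta t}) / (2 theta)).
  Note normal_density takes the standard deviation as second argument.\<close>

definition bm_trans :: "real \<Rightarrow> real \<Rightarrow> real \<Rightarrow> real \<Rightarrow> real" where
  "bm_trans \<sigma> t a b = normal_density a (\<sigma> * sqrt t) b"

definition ou_trans :: "real \<Rightarrow> real \<Rightarrow> real \<Rightarrow> real \<Rightarrow> real \<Rightarrow> real" where
  "ou_trans \<theta> \<sigma> t a b =
     normal_density (a * exp (- \<theta> * t)) (\<sigma> * sqrt ((1 - exp (- 2 * \<theta> * t)) / (2 * \<theta>))) b"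

text \<open>Knot vectors (X_{k_1},...,X_{k_m}) are functions nat => real, extensional on {1..m}
  (coordinate i is X at time k_i = i * delta, delta = T/(m+1)).\<close>

definition knot_space :: "nat \<Rightarrow> (nat \<Rightarrow> real) measure" where
  "knot_space m = PiM {1..m} (\<lambda>_. lborel)"

definition knot_delta :: "real \<Rightarrow> nat \<Rightarrow> real" where
  "knot_delta T m = T / (real m + 1)"

text \<open>Unnormalised density (w.r.t. Lebesgue measure on R^m) of the knot vector
  conditioned on X_0 = x0, X_T = xT, for a Markov process with transition density p:
  the product of transition densities along 0 = k_0 < k_1 < ... < k_m < k_{m+1} = T.\<close>

definition bridge_dens ::
  "(real \<Rightarrow> real \<Rightarrow> real \<Rightarrow> real) \<Rightarrow> real \<Rightarrow> nat \<Rightarrow> real \<Rightarrow> real \<Rightarrow> (nat \<Rightarrow> real) \<Rightarrow> real" where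
  "bridge_dens p T m x0 xT x =
     (let y = (\<lambda>i. if i = 0 then x0 else if i = Suc m then xT else x i)
      in \<Prod>i\<in>{0..m}. p (knot_delta T m) (y i) (y (Suc i)))"

definition normalised :: "'a measure \<Rightarrow> ('a \<Rightarrow> real) \<Rightarrow> 'a measure" where
  "normalised M g = density M (\<lambda>x. ennreal (g x) / (\<integral>\<^sup>+ y. ennreal (g y) \<partial>M))"

definition bridge_law ::
  "(real \<Rightarrow> real \<Rightarrow> real \<Rightarrow> real) \<Rightarrow> real \<Rightarrow> nat \<Rightarrow> real \<Rightarrow> real \<Rightarrow> (nat \<Rightarrow> real) measure" where
  "bridge_law p T m x0 xT = normalised (knot_space m) (bridge_dens p T m x0 xT)"

text \<open>Joint update of the block A of coordinates from its conditional law given the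
  other coordinates of the current state x, for a target with (unnormalised) density g
  on R^m: the new block has density proportional to y |-> g(y on A, x off A),
  the other coordinates are kept.\<close>

definition block_update ::
  "nat \<Rightarrow> ((nat \<Rightarrow> real) \<Rightarrow> real) \<Rightarrow> nat set \<Rightarrow> (nat \<Rightarrow> real) \<Rightarrow> (nat \<Rightarrow> real) measure" where
  "block_update m g A x =
     distr (normalised (PiM A (\<lambda>_. lborel)) (\<lambda>y. g (merge A ({1..m} - A) (y, x))))
           (knot_space m) (\<lambda>y. merge A ({1..m} - A) (y, x))"

fun gibbs_sweep ::
  "nat \<Rightarrow> ((nat \<Rightarrow> real) \<Rightarrow> real) \<Rightarrow> nat set list \<Rightarrow> (nat \<Rightarrow> real) \<Rightarrow> (nat \<Rightarrow> real) measure" where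
  "gibbs_sweep m g [] x = return (knot_space m) x"
| "gibbs_sweep m g (A # As) x = block_update m g A x \<bind> gibbs_sweep m g As"

definition checkerboard_blocks :: "nat \<Rightarrow> nat set list" where
  "checkerboard_blocks m = [{i\<in>{1..m}. odd i}, {i\<in>{1..m}. even i}]"

definition lexicographic_blocks :: "nat \<Rightarrow> nat set list" where
  "lexicographic_blocks m = map (\<lambda>i. {i}) [1..<Suc m]"

fun kernel_pow ::
  "'a measure \<Rightarrow> ('a \<Rightarrow> 'a measure) \<Rightarrow> nat \<Rightarrow> 'a \<Rightarrow> 'a measure" where
  "kernel_pow M K 0 x = return M x"
| "kernel_pow M K (Suc n) x = kernel_pow M K n x \<bind> K"

definition kernel_apply ::
  "'a measure \<Rightarrow> ('a \<Rightarrow> 'a measure) \<Rightarrow> nat \<Rightarrow> ('a \<Rightarrow> real) \<Rightarrow> 'a \<Rightarrow> real" where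
  "kernel_apply M K n f x = (\<integral>y. f y \<partial>(kernel_pow M K n x))"

definition l2_rate_ok :: "'a measure \<Rightarrow> ('a \<Rightarrow> 'a measure) \<Rightarrow> real \<Rightarrow> bool" where
  "l2_rate_ok \<pi> K \<rho> \<longleftrightarrow>
     (\<forall>f. f \<in> borel_measurable \<pi> \<and> integrable \<pi> (\<lambda>x. (f x)\<^sup>2) \<longrightarrow>
        (\<forall>r>\<rho>. \<exists>V>0. \<forall>n.
           0 \<le> V * r ^ n \<and>
           (\<integral>\<^sup>+ x. ennreal ((kernel_apply \<pi> K n f x - (\<integral>y. f y \<partial>\<pi>))\<^sup>2) \<partial>\<pi>)
             \<le> ennreal (V * r ^ n)))"

definition l2_rate :: "'a measure \<Rightarrow> ('a \<Rightarrow> 'a measure) \<Rightarrow> real" where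
  "l2_rate \<pi> K = Inf {\<rho>. l2_rate_ok \<pi> K \<rho>}"

definition gibbs_rate ::
  "(real \<Rightarrow> real \<Rightarrow> real \<Rightarrow> real) \<Rightarrow> (nat \<Rightarrow> nat set list) \<Rightarrow> real \<Rightarrow> real \<Rightarrow> real \<Rightarrow> nat \<Rightarrow> real" where
  "gibbs_rate p blocks x0 xT T m =
     l2_rate (bridge_law p T m x0 xT) (gibbs_sweep m (bridge_dens p T m x0 xT) (blocks m))"

definition relax_time ::
  "(real \<Rightarrow> real \<Rightarrow> real \<Rightarrow> real) \<Rightarrow> (nat \<Rightarrow> nat set list) \<Rightarrow> real \<Rightarrow> real \<Rightarrow> real \<Rightarrow> nat \<Rightarrow> real" where
  "relax_time p blocks x0 xT T m = - 1 / ln (gibbs_rate p blocks x0 xT T m)"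

definition C_blocking ::
  "(real \<Rightarrow> real) \<Rightarrow> (real \<Rightarrow> real \<Rightarrow> real \<Rightarrow> real) \<Rightarrow> (nat \<Rightarrow> nat set list) \<Rightarrow> real \<Rightarrow> real \<Rightarrow> real \<Rightarrow> nat \<Rightarrow> real" where
  "C_blocking C_rej p blocks x0 xT T m =
     relax_time p blocks x0 xT T m * real m * C_rej (2 * T / (real m + 1))"

end

theory Submission
  imports Defs
begin

text \<open>The number of sweeps needed is bounded by a spectral gap estimate \<open>\<rho> \<le> 1 - 1 / (8 m\<^sup>2)\<close>, uniform in
  \<open>T\<close>, in the process and in the order of the updates; the cost is then \<open>O(m\<^sup>2 T)\<close>.

  A block update is affine in the current state with noise independent of it, so two copies driven by
  the same noise differ by a Gauss--Seidel iterate for the quadratic form of the bridge. One sweep, in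
  whatever order, contracts this form by \<open>1 - 1 / (8 m\<^sup>2)\<close>. Hence Lipschitz functions are contracted by the
  sweep, and a sweep turns every bounded function into a Lipschitz one. To bound \<open>L\<^sup>2\<close> norms without
  Hermite expansions, let \<open>P\<close> be the sweep operator, a product of self-adjoint operators, and \<open>Q = P\<^sup>* P\<close>.
  The sequence \<open>\<parallel>Q\<^sup>j f\<parallel>\<close> is log-convex, so its asymptotic decay rate for bounded centred \<open>f\<close> already
  bounds \<open>\<parallel>Q f\<parallel> / \<parallel>f\<parallel>\<close>, and \<open>\<parallel>P f\<parallel>\<^sup>2 = \<langle>f, Q f\<rangle> \<le> (1 - 1 / (8 m\<^sup>2)) \<parallel>f\<parallel>\<^sup>2\<close>; bounded functions are dense.\<close>

subsection \<open>Gauss--Seidel sweeps\<close>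

definition action :: "real \<Rightarrow> nat \<Rightarrow> (nat \<Rightarrow> real) \<Rightarrow> real" where
  "action \<alpha> m X = (\<Sum>j=0..m. (X (Suc j) - \<alpha> * X j)\<^sup>2)"

definition neighbour_weight :: "real \<Rightarrow> real" where
  "neighbour_weight \<alpha> = \<alpha> / (1 + \<alpha>\<^sup>2)"

definition residual :: "real \<Rightarrow> (nat \<Rightarrow> real) \<Rightarrow> nat \<Rightarrow> real" where
  "residual \<alpha> X i = X i - neighbour_weight \<alpha> * (X (i - 1) + X (Suc i))"

definition gs_update :: "real \<Rightarrow> nat set \<Rightarrow> (nat \<Rightarrow> real) \<Rightarrow> nat \<Rightarrow> real" where
  "gs_update \<alpha> A X i = (if i \<in> A then neighbour_weight \<alpha> * (X (i - 1) + X (Suc i)) else X i)"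

definition supported :: "nat \<Rightarrow> (nat \<Rightarrow> real) \<Rightarrow> bool" where
  "supported m e \<longleftrightarrow> (\<forall>i. i \<notin> {1..m} \<longrightarrow> e i = 0)"

definition independent_block :: "nat \<Rightarrow> nat set \<Rightarrow> bool" where
  "independent_block m A \<longleftrightarrow> A \<subseteq> {1..m} \<and> (\<forall>i\<in>A. Suc i \<notin> A)"

definition block_partition :: "nat \<Rightarrow> nat set list \<Rightarrow> bool" where
  "block_partition m As \<longleftrightarrow>
     sorted_wrt disjnt As \<and> (\<forall>A\<in>set As. independent_block m A) \<and> \<Union>(set As) = {1..m}"

lemma one_plus_square_pos: "0 < 1 + (x::real)\<^sup>2"
  by (intro add_pos_nonneg) auto

lemma abs_neighbour_weight_le: "\<bar>neighbour_weight \<alpha>\<bar> \<le> 1 / 2"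
  using sum_squares_bound[of 1 "\<bar>\<alpha>\<bar>"] one_plus_square_pos[of \<alpha>]
  by (simp add: neighbour_weight_def field_simps)

lemma supportedD: "supported m e \<Longrightarrow> e 0 = 0" "supported m e \<Longrightarrow> e (Suc m) = 0"
  by (auto simp: supported_def)

lemma independent_block_subset: "independent_block m A \<Longrightarrow> A \<subseteq> {1..m}"
  by (simp add: independent_block_def)

lemma independent_block_finite: "independent_block m A \<Longrightarrow> finite A"
  using finite_subset[OF independent_block_subset] by blast

lemma independent_block_neighbours:
  assumes "independent_block m A" "i \<in> A"
  shows "i - 1 \<notin> A" "Suc i \<notin> A" "i \<in> {1..m}"
  using assms by (cases i; force simp: independent_block_def)+

lemma block_partition_rev: "block_partition m As \<Longrightarrow> block_partition m (rev As)"
  by (simp add: block_partition_def sorted_wrt_rev disjnt_def[abs_def] Int_commute)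

lemma supported_gs_update:
  "supported m e \<Longrightarrow> independent_block m A \<Longrightarrow> supported m (gs_update \<alpha> A e)"
  by (auto simp: supported_def gs_update_def independent_block_def)

lemma sum_shift_down:
  fixes f :: "nat \<Rightarrow> real"
  assumes "f (Suc m) = 0"
  shows "(\<Sum>j=0..m. f (Suc j)) = (\<Sum>i=1..m. f i)"
  using assms sum.shift_bounds_cl_Suc_ivl[of f 0 m] by simp

lemma sum_drop_0:
  fixes f :: "nat \<Rightarrow> real"
  assumes "f 0 = 0"
  shows "(\<Sum>j=0..m. f j) = (\<Sum>i=1..m. f i)"
  using assms by (simp add: sum.atLeast_Suc_atMost)

lemma sum_increments_by_parts:
  assumes supp_U: "supported m U"
  shows "(\<Sum>j=0..m. (V (Suc j) - \<alpha> * V j) * (U (Suc j) - \<alpha> * U j))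
    = (1 + \<alpha>\<^sup>2) * (\<Sum>i=1..m. U i * residual \<alpha> V i)"
proof -
  have "(\<Sum>j=0..m. (V (Suc j) - \<alpha> * V j) * (U (Suc j) - \<alpha> * U j))
    = (\<Sum>j=0..m. U (Suc j) * (V (Suc j) - \<alpha> * V (Suc j - 1))) - \<alpha> * (\<Sum>j=0..m. U j * (V (Suc j) - \<alpha> * V j))"
    by (simp add: sum_distrib_left sum_subtractf[symmetric] algebra_simps)
  also have "\<dots> = (\<Sum>i=1..m. U i * (V i - \<alpha> * V (i - 1))) - \<alpha> * (\<Sum>i=1..m. U i * (V (Suc i) - \<alpha> * V i))"
    using sum_shift_down[of "\<lambda>i. U i * (V i - \<alpha> * V (i - 1))" m]
      sum_drop_0[of "\<lambda>j. U j * (V (Suc j) - \<alpha> * V j)" m] supportedD[OF supp_U] by simp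
  also have "\<dots> = (\<Sum>i=1..m. U i * ((1 + \<alpha>\<^sup>2) * V i - \<alpha> * (V (i - 1) + V (Suc i))))"
    unfolding sum_distrib_left sum_subtractf[symmetric]
    by (intro sum.cong refl) (simp add: power2_eq_square algebra_simps)
  also have "\<dots> = (\<Sum>i=1..m. (1 + \<alpha>\<^sup>2) * (U i * residual \<alpha> V i))"
    using one_plus_square_pos[of \<alpha>]
    by (intro sum.cong refl) (simp add: residual_def neighbour_weight_def field_simps)
  finally show ?thesis by (simp add: sum_distrib_left)
qed

lemma action_nonneg: "0 \<le> action \<alpha> m X"
  by (simp add: action_def sum_nonneg)

lemma action_eq_sum_residual:
  assumes "supported m U"
  shows "action \<alpha> m U = (1 + \<alpha>\<^sup>2) * (\<Sum>i=1..m. U i * residual \<alpha> U i)"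
  using sum_increments_by_parts[OF assms, of U \<alpha>] by (simp add: action_def power2_eq_square)

lemma action_add:
  assumes supp_U: "supported m U"
  shows "action \<alpha> m (\<lambda>i. V i + U i)
    = action \<alpha> m V + action \<alpha> m U + 2 * (1 + \<alpha>\<^sup>2) * (\<Sum>i=1..m. U i * residual \<alpha> V i)"
proof -
  have "action \<alpha> m (\<lambda>i. V i + U i) = action \<alpha> m V + action \<alpha> m U
      + 2 * (\<Sum>j=0..m. (V (Suc j) - \<alpha> * V j) * (U (Suc j) - \<alpha> * U j))"
    unfolding action_def sum_distrib_left sum.distrib[symmetric]
    by (intro sum.cong refl) (simp add: power2_eq_square algebra_simps)
  then show ?thesis by (simp add: sum_increments_by_parts[OF supp_U])
qed

text \<open>Up to scale, the action of a path is minus its log density under the bridge law. Completing the square,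
  its minimiser over the entries in \<open>A\<close> is the conditional mean of that block.\<close>

lemma action_eq_gs_update:
  assumes block: "independent_block m A" and off_block: "\<And>i. i \<notin> A \<Longrightarrow> Y i = X i"
  shows "action \<alpha> m Y = action \<alpha> m (gs_update \<alpha> A X) + (1 + \<alpha>\<^sup>2) * (\<Sum>i\<in>A. (Y i - gs_update \<alpha> A X i)\<^sup>2)"
proof -
  define Z where "Z = gs_update \<alpha> A X"
  define U where "U i = Y i - Z i" for i
  have U_off_block: "U i = 0" if "i \<notin> A" for i
    using that off_block by (simp add: U_def Z_def gs_update_def)
  then have supp_U: "supported m U"
    using independent_block_subset[OF block] unfolding supported_def by blast
  have sum_on_block: "(\<Sum>i=1..m. U i * w i) = (\<Sum>i\<in>A. U i * w i)" for w
    using independent_block_subset[OF block] U_off_block by (intro sum.mono_neutral_right) auto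
  have residual_Z: "residual \<alpha> Z i = 0" and residual_U: "residual \<alpha> U i = U i" if "i \<in> A" for i
    using that U_off_block independent_block_neighbours[OF block that]
    by (simp_all add: residual_def Z_def gs_update_def)
  have "action \<alpha> m Y = action \<alpha> m Z + action \<alpha> m U + 2 * (1 + \<alpha>\<^sup>2) * (\<Sum>i=1..m. U i * residual \<alpha> Z i)"
    using action_add[OF supp_U, of \<alpha> Z] by (simp add: U_def)
  also have "(\<Sum>i=1..m. U i * residual \<alpha> Z i) = 0" unfolding sum_on_block by (simp add: residual_Z)
  also have "action \<alpha> m U = (1 + \<alpha>\<^sup>2) * (\<Sum>i\<in>A. (U i)\<^sup>2)"
    unfolding action_eq_sum_residual[OF supp_U] sum_on_block
    by (simp add: residual_U power2_eq_square)
  finally show ?thesis by (simp add: Z_def U_def)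
qed

lemma gs_sweep_outside:
  "i \<notin> \<Union>(set As) \<Longrightarrow> fold (gs_update \<alpha>) As e i = e i"
  by (induction As arbitrary: e) (auto simp: gs_update_def)

lemma supported_gs_sweep:
  "supported m e \<Longrightarrow> \<forall>A\<in>set As. independent_block m A \<Longrightarrow> supported m (fold (gs_update \<alpha>) As e)"
  by (induction As arbitrary: e) (auto intro: supported_gs_update)

lemma gs_sweep_inside:
  fixes \<alpha> :: real and e :: "nat \<Rightarrow> real"
  assumes "sorted_wrt disjnt As" "i \<in> \<Union>(set As)"
  defines "f \<equiv> fold (gs_update \<alpha>) As e"
  shows "\<exists>a\<in>{e (i - 1), f (i - 1)}. \<exists>b\<in>{e (Suc i), f (Suc i)}. f i = neighbour_weight \<alpha> * (a + b)"
  using assms(1,2) unfolding f_def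
proof (induction As arbitrary: e)
  case (Cons A As)
  define e' where "e' = gs_update \<alpha> A e"
  define f where "f = fold (gs_update \<alpha>) As e'"
  have updated: "f j = e' j" if "j \<in> A" for j
    unfolding f_def using that Cons.prems(1) by (intro gs_sweep_outside) (auto simp: disjnt_iff)
  have e': "e' j \<in> {e j, f j}" for j
    using updated[of j] by (cases "j \<in> A") (auto simp: e'_def gs_update_def)
  have "\<exists>a\<in>{e (i - 1), f (i - 1)}. \<exists>b\<in>{e (Suc i), f (Suc i)}. f i = neighbour_weight \<alpha> * (a + b)"
  proof (cases "i \<in> A")
    case True
    then show ?thesis using updated by (simp add: e'_def gs_update_def)
  next
    case False
    then have "\<exists>a\<in>{e' (i - 1), f (i - 1)}. \<exists>b\<in>{e' (Suc i), f (Suc i)}. f i = neighbour_weight \<alpha> * (a + b)"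
      unfolding f_def using Cons by (intro Cons.IH) auto
    then show ?thesis using e'[of "i - 1"] e'[of "Suc i"] by auto
  qed
  then show ?case by (simp add: f_def e'_def)
qed simp

lemma action_gs_sweep:
  fixes \<alpha> :: real and e :: "nat \<Rightarrow> real"
  assumes "sorted_wrt disjnt As" "\<forall>A\<in>set As. independent_block m A"
  defines "f \<equiv> fold (gs_update \<alpha>) As e"
  shows "action \<alpha> m e = action \<alpha> m f + (1 + \<alpha>\<^sup>2) * (\<Sum>i\<in>\<Union>(set As). (e i - f i)\<^sup>2)"
  using assms(1,2) unfolding f_def
proof (induction As arbitrary: e)
  case (Cons A As)
  define e' where "e' = gs_update \<alpha> A e"
  define f where "f = fold (gs_update \<alpha>) As e'"
  define U where "U = \<Union>(set As)"
  have disjoint: "A \<inter> U = {}" using Cons.prems by (auto simp: U_def disjnt_iff)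
  have finite_blocks: "finite A" "finite U"
    using Cons.prems by (auto simp: U_def intro: independent_block_finite)
  have "action \<alpha> m e = action \<alpha> m e' + (1 + \<alpha>\<^sup>2) * (\<Sum>i\<in>A. (e i - e' i)\<^sup>2)"
    unfolding e'_def using Cons.prems by (intro action_eq_gs_update) auto
  also have "(\<Sum>i\<in>A. (e i - e' i)\<^sup>2) = (\<Sum>i\<in>A. (e i - f i)\<^sup>2)"
    unfolding f_def
    using disjoint by (intro sum.cong refl) (subst gs_sweep_outside, auto simp: U_def)
  also have "action \<alpha> m e' = action \<alpha> m f + (1 + \<alpha>\<^sup>2) * (\<Sum>i\<in>U. (e' i - f i)\<^sup>2)"
    unfolding f_def U_def using Cons.prems by (intro Cons.IH) auto
  also have "(\<Sum>i\<in>U. (e' i - f i)\<^sup>2) = (\<Sum>i\<in>U. (e i - f i)\<^sup>2)"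
  proof (intro sum.cong refl)
    fix i assume "i \<in> U"
    then have "i \<notin> A" using disjoint by blast
    then show "(e' i - f i)\<^sup>2 = (e i - f i)\<^sup>2" by (simp add: e'_def gs_update_def)
  qed
  finally show ?case
    using finite_blocks disjoint
    by (simp add: sum.union_disjoint f_def e'_def U_def[symmetric] distrib_left)
qed simp

lemma abs_le_sum_increments:
  fixes X :: "nat \<Rightarrow> 'a::linordered_idom"
  assumes "\<bar>\<alpha>\<bar> \<le> 1"
  shows "\<bar>X i\<bar> \<le> \<bar>X 0\<bar> + (\<Sum>j<i. \<bar>X (Suc j) - \<alpha> * X j\<bar>)"
proof (induction i)
  case (Suc i)
  have "\<bar>X (Suc i)\<bar> \<le> \<bar>\<alpha> * X i\<bar> + \<bar>X (Suc i) - \<alpha> * X i\<bar>"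
    using abs_triangle_ineq[of "\<alpha> * X i" "X (Suc i) - \<alpha> * X i"] by simp
  also have "\<bar>\<alpha> * X i\<bar> \<le> \<bar>X i\<bar>" using mult_right_mono[OF assms, of "\<bar>X i\<bar>"] by (simp add: abs_mult)
  finally show ?case using Suc.IH by simp
qed simp

lemma abs_le_sqrt_action:
  assumes "\<bar>\<alpha>\<bar> \<le> 1" "i \<le> m"
  shows "\<bar>X i\<bar> \<le> \<bar>X 0\<bar> + sqrt (real m * action \<alpha> m X)"
proof -
  define d where "d j = \<bar>X (Suc j) - \<alpha> * X j\<bar>" for j
  have "(\<Sum>j<i. 1 * d j)\<^sup>2 \<le> (\<Sum>j<i. 1\<^sup>2) * (\<Sum>j<i. (d j)\<^sup>2)" by (rule Cauchy_Schwarz_ineq_sum)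
  also have "\<dots> \<le> real m * action \<alpha> m X"
    using assms(2)
    unfolding action_def d_def power2_abs by (intro mult_mono sum_mono2) (auto intro: sum_nonneg)
  finally have "(\<Sum>j<i. d j) \<le> sqrt (real m * action \<alpha> m X)" by (simp add: real_le_rsqrt)
  then show ?thesis using abs_le_sum_increments[OF assms(1), of X i] by (simp add: d_def)
qed

lemma sum_squares_le_action:
  assumes "\<bar>\<alpha>\<bar> \<le> 1" "supported m e"
  shows "(\<Sum>i=1..m. (e i)\<^sup>2) \<le> (real m)\<^sup>2 * action \<alpha> m e"
proof -
  have "(e i)\<^sup>2 \<le> real m * action \<alpha> m e" if "i \<in> {1..m}" for i
  proof -
    have "\<bar>e i\<bar>\<^sup>2 \<le> (sqrt (real m * action \<alpha> m e))\<^sup>2"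
      using abs_le_sqrt_action[OF assms(1), of i m e] that supportedD[OF assms(2)]
      by (intro power_mono) auto
    then show ?thesis by (simp add: action_nonneg)
  qed
  then show ?thesis
    using sum_mono[of "{1..m}" "\<lambda>i. (e i)\<^sup>2" "\<lambda>_. real m * action \<alpha> m e"]
    by (simp add: power2_eq_square)
qed

lemma sum_squares_shift_le:
  assumes "supported m d"
  shows "(\<Sum>i=1..m. (d (i - 1))\<^sup>2) \<le> (\<Sum>i=1..m. (d i)\<^sup>2)"
    and "(\<Sum>i=1..m. (d (Suc i))\<^sup>2) \<le> (\<Sum>i=1..m. (d i)\<^sup>2)"
proof -
  have "(\<Sum>i=1..m. (d (i - 1))\<^sup>2) \<le> (\<Sum>i=1..Suc m. (d (i - 1))\<^sup>2)" by (rule sum_mono2) auto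
  also have "\<dots> = (\<Sum>j=0..m. (d j)\<^sup>2)"
    using sum.shift_bounds_cl_Suc_ivl[of "\<lambda>i. (d (i - 1))\<^sup>2" 0 m] by simp
  also have "\<dots> = (\<Sum>i=1..m. (d i)\<^sup>2)" using supportedD[OF assms] by (intro sum_drop_0) simp
  finally show "(\<Sum>i=1..m. (d (i - 1))\<^sup>2) \<le> (\<Sum>i=1..m. (d i)\<^sup>2)" .
  have "(\<Sum>i=1..m. (d (Suc i))\<^sup>2) \<le> (\<Sum>j=0..m. (d (Suc j))\<^sup>2)" by (rule sum_mono2) auto
  also have "\<dots> = (\<Sum>i=1..m. (d i)\<^sup>2)"
    using supportedD[OF assms] by (intro sum_shift_down[of "\<lambda>i. (d i)\<^sup>2"]) simp
  finally show "(\<Sum>i=1..m. (d (Suc i))\<^sup>2) \<le> (\<Sum>i=1..m. (d i)\<^sup>2)" .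
qed

lemma action_le_sum_squares:
  assumes \<alpha>: "\<bar>\<alpha>\<bar> \<le> 1" and supp_e: "supported m e"
  shows "action \<alpha> m e \<le> 4 * (\<Sum>i=1..m. (e i)\<^sup>2)"
proof -
  have "(a - \<alpha> * b)\<^sup>2 \<le> 2 * a\<^sup>2 + 2 * b\<^sup>2" for a b
  proof -
    have "(a - \<alpha> * b)\<^sup>2 + (a + \<alpha> * b)\<^sup>2 = 2 * a\<^sup>2 + 2 * (\<alpha>\<^sup>2 * b\<^sup>2)"
      by (simp add: power2_eq_square algebra_simps)
    moreover have "\<alpha>\<^sup>2 * b\<^sup>2 \<le> b\<^sup>2"
      using \<alpha> mult_right_mono[of "\<alpha>\<^sup>2" 1 "b\<^sup>2"] by (simp add: abs_square_le_1)
    ultimately show ?thesis using zero_le_power2[of "a + \<alpha> * b"] by linarith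
  qed
  then have "action \<alpha> m e \<le> (\<Sum>j=0..m. 2 * (e (Suc j))\<^sup>2 + 2 * (e j)\<^sup>2)"
    unfolding action_def by (intro sum_mono)
  also have "\<dots> = 2 * (\<Sum>j=0..m. (e (Suc j))\<^sup>2) + 2 * (\<Sum>j=0..m. (e j)\<^sup>2)"
    by (simp only: sum.distrib sum_distrib_left)
  also have "\<dots> = 4 * (\<Sum>i=1..m. (e i)\<^sup>2)"
    using sum_shift_down[of "\<lambda>i. (e i)\<^sup>2" m] sum_drop_0[of "\<lambda>i. (e i)\<^sup>2" m] supportedD[OF supp_e]
    by simp
  finally show ?thesis .
qed

lemma sum_squares_residual_le_displacement:
  fixes \<alpha> :: real
  assumes partition: "block_partition m As" and supp_e: "supported m e"
  defines "d \<equiv> (\<lambda>i. e i - fold (gs_update \<alpha>) As e i)"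
  shows "(\<Sum>i=1..m. (residual \<alpha> e i)\<^sup>2) \<le> 4 * (\<Sum>i=1..m. (d i)\<^sup>2)"
proof -
  define f where "f = fold (gs_update \<alpha>) As e"
  have supp_d: "supported m d"
    using supp_e supported_gs_sweep[OF supp_e, of As \<alpha>] partition
    by (simp add: supported_def d_def block_partition_def)
  have "(residual \<alpha> e i)\<^sup>2 \<le> 2 * (d i)\<^sup>2 + (d (i - 1))\<^sup>2 + (d (Suc i))\<^sup>2" if "i \<in> {1..m}" for i
  proof -
    have "sorted_wrt disjnt As" "i \<in> \<Union>(set As)"
      using partition that by (auto simp: block_partition_def)
    then obtain a b where neighbours: "a \<in> {e (i - 1), f (i - 1)}" "b \<in> {e (Suc i), f (Suc i)}"
      and f_value: "f i = neighbour_weight \<alpha> * (a + b)"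
      using gs_sweep_inside[of As i e \<alpha>] unfolding f_def by blast
    define u v where "u = e (i - 1) - a" and "v = e (Suc i) - b"
    have uv_le: "u\<^sup>2 \<le> (d (i - 1))\<^sup>2" "v\<^sup>2 \<le> (d (Suc i))\<^sup>2"
      using neighbours by (auto simp: u_def v_def d_def f_def)
    have "residual \<alpha> e i = d i - neighbour_weight \<alpha> * (u + v)"
      using f_value by (simp add: residual_def d_def f_def u_def v_def algebra_simps)
    moreover have "\<bar>neighbour_weight \<alpha> * (u + v)\<bar> \<le> \<bar>(u + v) / 2\<bar>"
      using mult_right_mono[OF abs_neighbour_weight_le, of "\<bar>u + v\<bar>" \<alpha>] by (simp add: abs_mult)
    ultimately have "\<bar>residual \<alpha> e i\<bar> \<le> \<bar>d i\<bar> + \<bar>(u + v) / 2\<bar>" by linarith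
    then have "\<bar>residual \<alpha> e i\<bar>\<^sup>2 \<le> (\<bar>d i\<bar> + \<bar>(u + v) / 2\<bar>)\<^sup>2" by (intro power_mono) auto
    also have "\<dots> \<le> 2 * \<bar>d i\<bar>\<^sup>2 + 2 * \<bar>(u + v) / 2\<bar>\<^sup>2"
      using sum_squares_bound[of "\<bar>d i\<bar>" "\<bar>(u + v) / 2\<bar>"] unfolding power2_sum by linarith
    also have "2 * \<bar>(u + v) / 2\<bar>\<^sup>2 \<le> u\<^sup>2 + v\<^sup>2"
      using sum_squares_bound[of u v] unfolding power2_abs by (simp add: power_divide power2_sum)
    finally show ?thesis using uv_le by simp
  qed
  then have "(\<Sum>i=1..m. (residual \<alpha> e i)\<^sup>2) \<le> (\<Sum>i=1..m. 2 * (d i)\<^sup>2 + (d (i - 1))\<^sup>2 + (d (Suc i))\<^sup>2)"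
    by (rule sum_mono)
  also have "\<dots> = 2 * (\<Sum>i=1..m. (d i)\<^sup>2) + (\<Sum>i=1..m. (d (i - 1))\<^sup>2) + (\<Sum>i=1..m. (d (Suc i))\<^sup>2)"
    by (simp only: sum.distrib sum_distrib_left)
  finally show ?thesis using sum_squares_shift_le[OF supp_d] by linarith
qed

text \<open>Every coordinate moves exactly once in a sweep, so the action drops by \<open>1 + \<alpha>\<^sup>2\<close> times the squared
  length of the total displacement. The displacement controls the residual before the sweep, and the
  discrete Poincare inequality turns this into a relative decrease of order \<open>1 / m\<^sup>2\<close>.\<close>

lemma action_gs_sweep_le:
  assumes partition: "block_partition m As" and \<alpha>: "\<bar>\<alpha>\<bar> \<le> 1" and m: "1 \<le> m"
    and supp_e: "supported m e"
  shows "action \<alpha> m (fold (gs_update \<alpha>) As e) \<le> (1 - 1 / (8 * (real m)\<^sup>2)) * action \<alpha> m e"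
proof -
  define f where "f = fold (gs_update \<alpha>) As e"
  define E where "E = action \<alpha> m e"
  define D where "D = (1 + \<alpha>\<^sup>2) * (\<Sum>i=1..m. (e i - f i)\<^sup>2)"
  define k where "k = 1 + \<alpha>\<^sup>2"
  have k_bounds: "0 < k" "k \<le> 2" using one_plus_square_pos \<alpha> by (auto simp: k_def abs_square_le_1)
  have E_nonneg: "0 \<le> E" and D_nonneg: "0 \<le> D"
    by (simp_all add: E_def D_def action_nonneg sum_nonneg)
  have drop: "E = action \<alpha> m f + D"
    using action_gs_sweep[of As m \<alpha> e] partition
    by (simp add: E_def D_def f_def block_partition_def)
  have "(E / k)\<^sup>2 \<le> (\<Sum>i=1..m. (e i)\<^sup>2) * (\<Sum>i=1..m. (residual \<alpha> e i)\<^sup>2)"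
    using Cauchy_Schwarz_ineq_sum[of e "residual \<alpha> e" "{1..m}"] k_bounds action_eq_sum_residual[OF supp_e, of \<alpha>]
    by (simp add: E_def k_def)
  also have "\<dots> \<le> ((real m)\<^sup>2 * E) * (4 * (D / k))"
    using sum_squares_le_action[OF \<alpha> supp_e] sum_squares_residual_le_displacement[OF partition supp_e] k_bounds
    by (intro mult_mono) (auto simp: E_def D_def k_def f_def sum_nonneg action_nonneg)
  finally have "E * E \<le> E * (4 * k * (real m)\<^sup>2 * D)"
    using k_bounds by (simp add: power2_eq_square field_simps)
  also have "\<dots> \<le> E * (8 * (real m)\<^sup>2 * D)"
    using E_nonneg D_nonneg k_bounds by (intro mult_left_mono mult_right_mono) auto
  finally have "E \<le> 8 * (real m)\<^sup>2 * D" using E_nonneg D_nonneg by (cases "E = 0") auto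
  then have "E / (8 * (real m)\<^sup>2) \<le> D" using m by (simp add: field_simps)
  then show ?thesis using drop by (simp add: E_def f_def algebra_simps)
qed

subsection \<open>Markov kernels on square-integrable functions\<close>

definition kernel_op :: "('a \<Rightarrow> 'b measure) \<Rightarrow> ('b \<Rightarrow> real) \<Rightarrow> 'a \<Rightarrow> real" where
  "kernel_op K f x = (\<integral>y. f y \<partial>K x)"

primrec kernel_ops :: "('a \<Rightarrow> 'a measure) list \<Rightarrow> ('a \<Rightarrow> real) \<Rightarrow> 'a \<Rightarrow> real" where
  "kernel_ops [] f = f"
| "kernel_ops (K # Ks) f = kernel_op K (kernel_ops Ks f)"

definition bounded_measurable :: "'a measure \<Rightarrow> ('a \<Rightarrow> real) \<Rightarrow> bool" where
  "bounded_measurable M f \<longleftrightarrow> f \<in> borel_measurable M \<and> (\<exists>B. \<forall>x\<in>space M. \<bar>f x\<bar> \<le> B)"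

definition square_integrable :: "'a measure \<Rightarrow> ('a \<Rightarrow> real) \<Rightarrow> bool" where
  "square_integrable M f \<longleftrightarrow> f \<in> borel_measurable M \<and> integrable M (\<lambda>x. (f x)\<^sup>2)"

definition reversible_kernel :: "'a measure \<Rightarrow> ('a \<Rightarrow> 'a measure) \<Rightarrow> bool" where
  "reversible_kernel M K \<longleftrightarrow> K \<in> M \<rightarrow>\<^sub>M prob_algebra M \<and>
     (\<forall>f\<in>borel_measurable M. \<forall>g\<in>borel_measurable M.
       (\<integral>\<^sup>+x. g x * (\<integral>\<^sup>+y. f y \<partial>K x) \<partial>M) = (\<integral>\<^sup>+x. f x * (\<integral>\<^sup>+y. g y \<partial>K x) \<partial>M))"

definition clip :: "nat \<Rightarrow> real \<Rightarrow> real" where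
  "clip n t = max (- real n) (min (real n) t)"

lemma reversible_kernelD:
  assumes "reversible_kernel M K"
  shows "K \<in> M \<rightarrow>\<^sub>M prob_algebra M"
    and "f \<in> borel_measurable M \<Longrightarrow> g \<in> borel_measurable M \<Longrightarrow>
      (\<integral>\<^sup>+x. g x * (\<integral>\<^sup>+y. f y \<partial>K x) \<partial>M) = (\<integral>\<^sup>+x. f x * (\<integral>\<^sup>+y. g y \<partial>K x) \<partial>M)"
  using assms unfolding reversible_kernel_def by blast+

lemma kernel_ops_append: "kernel_ops (Ks @ Ls) f = kernel_ops Ks (kernel_ops Ls f)"
  by (induction Ks) auto

lemma markov_kernelD:
  assumes "K \<in> M \<rightarrow>\<^sub>M prob_algebra N" "x \<in> space M"
  shows "prob_space (K x)" "sets (K x) = sets N" "space (K x) = space N" "measurable (K x) L = measurable N L"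
  using measurable_space[OF assms] sets_eq_imp_space_eq[of "K x" N] measurable_cong_sets[of "K x" N L L]
  by (auto simp: space_prob_algebra)

lemma kernel_op_measurable[measurable]:
  assumes "K \<in> M \<rightarrow>\<^sub>M prob_algebra N" "f \<in> borel_measurable N"
  shows "kernel_op K f \<in> borel_measurable M"
  unfolding kernel_op_def[abs_def]
  using measurable_compose[OF measurable_prob_algebraD[OF assms(1)]
      integral_measurable_subprob_algebra[OF assms(2)]] .

lemma bounded_measurableE:
  assumes "bounded_measurable M f"
  obtains B where "0 \<le> B" "\<And>x. x \<in> space M \<Longrightarrow> \<bar>f x\<bar> \<le> B"
proof -
  obtain B where "\<And>x. x \<in> space M \<Longrightarrow> \<bar>f x\<bar> \<le> B" using assms by (auto simp: bounded_measurable_def)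
  then have "\<And>x. x \<in> space M \<Longrightarrow> \<bar>f x\<bar> \<le> max 0 B" by fastforce
  then show ?thesis by (intro that[of "max 0 B"]) auto
qed

lemma bounded_measurable_measurable: "bounded_measurable M f \<Longrightarrow> f \<in> borel_measurable M"
  by (simp add: bounded_measurable_def)

lemma bounded_measurable_integrable:
  assumes f: "bounded_measurable M f" and N: "prob_space N" "sets N = sets M"
  shows "integrable N f"
proof -
  interpret N: prob_space N by fact
  obtain B where "\<And>x. x \<in> space M \<Longrightarrow> \<bar>f x\<bar> \<le> B" using bounded_measurableE[OF f] by blast
  then show ?thesis using bounded_measurable_measurable[OF f] sets_eq_imp_space_eq[OF N(2)] N(2)
    by (intro N.integrable_const_bound[where B=B]) (auto cong: measurable_cong_sets)
qed

lemma bounded_measurable_const: "bounded_measurable M (\<lambda>_. c)"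
  by (auto simp: bounded_measurable_def)

lemma bounded_measurable_arith:
  assumes f: "bounded_measurable M f" and g: "bounded_measurable M g"
  shows "bounded_measurable M (\<lambda>x. f x * g x)" "bounded_measurable M (\<lambda>x. f x + g x)"
    "bounded_measurable M (\<lambda>x. f x - g x)"
proof -
  note [measurable] = bounded_measurable_measurable[OF f] bounded_measurable_measurable[OF g]
  obtain B where f_le: "\<And>x. x \<in> space M \<Longrightarrow> \<bar>f x\<bar> \<le> B" using bounded_measurableE[OF f] by blast
  obtain C where g_le: "\<And>x. x \<in> space M \<Longrightarrow> \<bar>g x\<bar> \<le> C" using bounded_measurableE[OF g] by blast
  have "\<bar>f x * g x\<bar> \<le> B * C" "\<bar>f x + g x\<bar> \<le> B + C" "\<bar>f x - g x\<bar> \<le> B + C" if "x \<in> space M" for x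
    using f_le[OF that] g_le[OF that] by (auto simp: abs_mult intro!: mult_mono)
  then show "bounded_measurable M (\<lambda>x. f x * g x)" "bounded_measurable M (\<lambda>x. f x + g x)"
    "bounded_measurable M (\<lambda>x. f x - g x)"
    unfolding bounded_measurable_def by (auto intro!: exI)
qed

lemma bounded_measurable_kernel_op:
  assumes K: "K \<in> M \<rightarrow>\<^sub>M prob_algebra N" and f: "bounded_measurable N f"
  shows "bounded_measurable M (kernel_op K f)"
proof -
  obtain B where f_le: "\<And>x. x \<in> space N \<Longrightarrow> \<bar>f x\<bar> \<le> B" using bounded_measurableE[OF f] by blast
  have "\<bar>kernel_op K f x\<bar> \<le> B" if x: "x \<in> space M" for x
  proof -
    interpret Kx: prob_space "K x" using markov_kernelD[OF K x] by simp
    have "integrable (K x) f"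
      using f markov_kernelD[OF K x] by (intro bounded_measurable_integrable)
    then have "(\<integral>y. \<bar>f y\<bar> \<partial>K x) \<le> B"
      using f_le markov_kernelD[OF K x] by (intro Kx.integral_le_const) auto
    then show ?thesis using integral_abs_bound[of "K x" f] unfolding kernel_op_def by linarith
  qed
  then show ?thesis
    using K bounded_measurable_measurable[OF f] by (auto simp: bounded_measurable_def)
qed

lemma kernel_op_add_const:
  assumes K: "K \<in> M \<rightarrow>\<^sub>M prob_algebra N" and f: "bounded_measurable N f" and x: "x \<in> space M"
  shows "kernel_op K (\<lambda>y. f y + c) x = kernel_op K f x + c"
proof -
  interpret Kx: prob_space "K x" using markov_kernelD[OF K x] by simp
  have "integrable (K x) f" using f markov_kernelD[OF K x] by (intro bounded_measurable_integrable)
  then show ?thesis using Kx.prob_space by (simp add: kernel_op_def)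
qed

lemma kernel_op_bind:
  assumes K: "K \<in> M \<rightarrow>\<^sub>M prob_algebra N" and L: "L \<in> N \<rightarrow>\<^sub>M prob_algebra R"
    and f: "bounded_measurable R f" and x: "x \<in> space M"
  shows "kernel_op (\<lambda>x. K x \<bind> L) f x = kernel_op K (kernel_op L f) x"
proof -
  note Kx = markov_kernelD[OF K x]
  obtain B where f_le: "\<And>x. x \<in> space R \<Longrightarrow> \<bar>f x\<bar> \<le> B" using bounded_measurableE[OF f] by blast
  show ?thesis unfolding kernel_op_def
  proof (rule integral_bind[OF bounded_measurable_measurable[OF f] f_le])
    show "L \<in> K x \<rightarrow>\<^sub>M subprob_algebra R" using measurable_prob_algebraD[OF L] by (simp only: Kx(4))
    show "finite_measure (K x)" using Kx(1) by (simp add: prob_space_def)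
    show "AE y in K x. emeasure (L y) (space (L y)) \<le> ennreal 1"
      using markov_kernelD(1)[OF L] by (intro AE_I2) (simp add: Kx(3) prob_space.emeasure_space_1)
  qed
qed

lemma abs_clip_le: "\<bar>clip n t\<bar> \<le> real n" "\<bar>clip n t\<bar> \<le> \<bar>t\<bar>"
  by (auto simp: clip_def)

lemma clip_measurable[measurable]: "clip n \<in> borel_measurable borel"
  unfolding clip_def by measurable

lemma clip_tendsto: "(\<lambda>n. clip n t) \<longlonglongrightarrow> t"
proof (rule tendsto_eventually)
  have "clip n t = t" if "nat \<lceil>\<bar>t\<bar>\<rceil> \<le> n" for n
    using that unfolding clip_def by linarith
  then show "eventually (\<lambda>n. clip n t = t) sequentially" unfolding eventually_sequentially by blast
qed

lemma bounded_measurable_clip: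
  "f \<in> borel_measurable M \<Longrightarrow> bounded_measurable M (\<lambda>x. clip n (f x))"
  using abs_clip_le(1)
  by (auto simp: bounded_measurable_def intro: measurable_compose[OF _ clip_measurable])

lemma AE_integrable_bind:
  fixes f :: "'b \<Rightarrow> real"
  assumes N[measurable]: "N \<in> M \<rightarrow>\<^sub>M subprob_algebra B" and M: "space M \<noteq> {}"
    and int_f: "integrable (M \<bind> N) f"
  shows "AE x in M. integrable (N x) f" and "integrable M (\<lambda>x. \<integral>y. \<bar>f y\<bar> \<partial>N x)"
proof -
  have [measurable]: "f \<in> borel_measurable B"
    using borel_measurable_integrable[OF int_f]
    by (simp add: measurable_cong_sets[OF sets_bind[OF _ M]] subprob_measurableD(2)[OF N])
  have f_measurable: "f \<in> borel_measurable (N x)" if "x \<in> space M" for x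
    using that subprob_measurableD[OF N] by simp
  have norm_finite: "(\<integral>\<^sup>+x. (\<integral>\<^sup>+y. norm (f y) \<partial>N x) \<partial>M) < \<infinity>"
    using int_f N
    by (subst nn_integral_bind[symmetric, where B=B]) (auto simp: integrable_iff_bounded)
  then have "AE x in M. (\<integral>\<^sup>+y. norm (f y) \<partial>N x) \<noteq> \<infinity>" by (intro nn_integral_PInf_AE) auto
  then show AE_integrable: "AE x in M. integrable (N x) f"
    using f_measurable by (auto simp: integrable_iff_bounded top.not_eq_extremum)
  then have "AE x in M. (\<integral>\<^sup>+y. norm (f y) \<partial>N x) = ennreal (norm (\<integral>y. \<bar>f y\<bar> \<partial>N x))"
    by eventually_elim (simp add: nn_integral_eq_integral)
  then show "integrable M (\<lambda>x. \<integral>y. \<bar>f y\<bar> \<partial>N x)"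
    using norm_finite by (intro integrableI_bounded) (auto simp: nn_integral_cong_AE)
qed

lemma integral_bind_integrable:
  fixes f :: "'b \<Rightarrow> real"
  assumes N[measurable]: "N \<in> M \<rightarrow>\<^sub>M prob_algebra B" and M: "prob_space M"
    and int_f: "integrable (M \<bind> N) f"
  shows "integrable M (\<lambda>x. \<integral>y. f y \<partial>N x)" and "(\<integral>x. f x \<partial>(M \<bind> N)) = (\<integral>x. (\<integral>y. f y \<partial>N x) \<partial>M)"
proof -
  interpret M: prob_space M by fact
  note sub = measurable_prob_algebraD[OF N]
  have [measurable]: "f \<in> borel_measurable B"
    using borel_measurable_integrable[OF int_f]
    by (simp add: measurable_cong_sets[OF sets_bind[OF _ M.not_empty]] markov_kernelD(2)[OF N])
  note AE = AE_integrable_bind[OF sub M.not_empty int_f]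
  have bound: "AE x in M. norm (\<integral>y. clip n (f y) \<partial>N x) \<le> (\<integral>y. \<bar>f y\<bar> \<partial>N x)" for n
    using AE(1) AE_space
  proof eventually_elim
    case (elim x)
    have "norm (\<integral>y. clip n (f y) \<partial>N x) \<le> (\<integral>y. \<bar>clip n (f y)\<bar> \<partial>N x)" by simp
    also have "\<dots> \<le> (\<integral>y. \<bar>f y\<bar> \<partial>N x)" using elim(1) abs_clip_le(2) by (intro integral_mono') auto
    finally show ?case .
  qed
  have limit: "AE x in M. (\<lambda>n. \<integral>y. clip n (f y) \<partial>N x) \<longlonglongrightarrow> (\<integral>y. f y \<partial>N x)"
    using AE(1) AE_space
  proof eventually_elim
    case (elim x)
    then show ?case using markov_kernelD[OF N] abs_clip_le(2) clip_tendsto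
      by (intro integral_dominated_convergence[where w="\<lambda>y. \<bar>f y\<bar>"]) auto
  qed
  have "(\<lambda>x. \<integral>y. f y \<partial>N x) \<in> borel_measurable M" "(\<lambda>x. \<integral>y. clip n (f y) \<partial>N x) \<in> borel_measurable M" for n
    using kernel_op_measurable[OF N, of f] kernel_op_measurable[OF N, of "\<lambda>y. clip n (f y)"]
    by (simp_all add: kernel_op_def[abs_def])
  note conv = this AE(2) limit bound
  show "integrable M (\<lambda>x. \<integral>y. f y \<partial>N x)" using conv by (rule integrable_dominated_convergence)
  have "(\<lambda>n. \<integral>x. (\<integral>y. clip n (f y) \<partial>N x) \<partial>M) \<longlonglongrightarrow> (\<integral>x. (\<integral>y. f y \<partial>N x) \<partial>M)"
    using conv by (rule integral_dominated_convergence)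
  moreover have "(\<integral>x. clip n (f x) \<partial>(M \<bind> N)) = (\<integral>x. (\<integral>y. clip n (f y) \<partial>N x) \<partial>M)" for n
    using abs_clip_le(1) markov_kernelD(1)[OF N] sub M.finite_measure_axioms
    by (intro integral_bind[where B="real n" and B'=1]) (auto simp: prob_space.emeasure_space_1)
  moreover have "(\<lambda>n. \<integral>x. clip n (f x) \<partial>(M \<bind> N)) \<longlonglongrightarrow> (\<integral>x. f x \<partial>(M \<bind> N))"
    using int_f abs_clip_le(2) clip_tendsto
    by (intro integral_dominated_convergence[where w="\<lambda>x. \<bar>f x\<bar>"]) auto
  ultimately show "(\<integral>x. f x \<partial>(M \<bind> N)) = (\<integral>x. (\<integral>y. f y \<partial>N x) \<partial>M)" by (simp add: LIMSEQ_unique)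
qed

lemma Cauchy_Schwarz_integral:
  assumes f: "square_integrable M f" and g: "square_integrable M g"
  shows "integrable M (\<lambda>x. f x * g x)" "(\<integral>x. f x * g x \<partial>M)\<^sup>2 \<le> (\<integral>x. (f x)\<^sup>2 \<partial>M) * (\<integral>x. (g x)\<^sup>2 \<partial>M)"
proof -
  have [measurable]: "f \<in> borel_measurable M" "g \<in> borel_measurable M"
    and squares: "integrable M (\<lambda>x. (f x)\<^sup>2)" "integrable M (\<lambda>x. (g x)\<^sup>2)"
    using f g by (auto simp: square_integrable_def)
  show int_product: "integrable M (\<lambda>x. f x * g x)"
  proof (rule Bochner_Integration.integrable_bound)
    show "integrable M (\<lambda>x. (f x)\<^sup>2 + (g x)\<^sup>2)" using squares by simp
    have "2 * \<bar>a * b\<bar> \<le> a\<^sup>2 + b\<^sup>2" for a b :: real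
      using sum_squares_bound[of "\<bar>a\<bar>" "\<bar>b\<bar>"] by (simp add: abs_mult mult.assoc)
    then have "\<bar>a * b\<bar> \<le> a\<^sup>2 + b\<^sup>2" for a b :: real using abs_ge_zero[of "a * b"] by (smt (verit))
    then show "AE x in M. norm (f x * g x) \<le> norm ((f x)\<^sup>2 + (g x)\<^sup>2)" by simp
  qed measurable
  have "ennreal ((\<integral>x. \<bar>f x * g x\<bar> \<partial>M)\<^sup>2) = (\<integral>\<^sup>+x. ennreal \<bar>f x\<bar> * ennreal \<bar>g x\<bar> \<partial>M)\<^sup>2"
    using int_product
    by (simp add: nn_integral_eq_integral ennreal_mult[symmetric] abs_mult[symmetric] ennreal_power)
  also have "\<dots> \<le> (\<integral>\<^sup>+x. ennreal \<bar>f x\<bar> ^ 2 \<partial>M) * (\<integral>\<^sup>+x. ennreal \<bar>g x\<bar> ^ 2 \<partial>M)"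
    by (intro Cauchy_Schwarz_nn_integral) auto
  also have "\<dots> = ennreal ((\<integral>x. (f x)\<^sup>2 \<partial>M) * (\<integral>x. (g x)\<^sup>2 \<partial>M))"
    using squares by (simp add: ennreal_power nn_integral_eq_integral ennreal_mult)
  finally have "(\<integral>x. \<bar>f x * g x\<bar> \<partial>M)\<^sup>2 \<le> (\<integral>x. (f x)\<^sup>2 \<partial>M) * (\<integral>x. (g x)\<^sup>2 \<partial>M)"
    by (simp add: ennreal_le_iff)
  moreover have "\<bar>\<integral>x. f x * g x \<partial>M\<bar>\<^sup>2 \<le> (\<integral>x. \<bar>f x * g x\<bar> \<partial>M)\<^sup>2"
    by (intro power_mono integral_abs_bound) auto
  ultimately show "(\<integral>x. f x * g x \<partial>M)\<^sup>2 \<le> (\<integral>x. (f x)\<^sup>2 \<partial>M) * (\<integral>x. (g x)\<^sup>2 \<partial>M)" by simp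
qed

lemma log_convex_ratio_le:
  fixes v :: "nat \<Rightarrow> real"
  assumes nonneg: "\<And>j. 0 \<le> v j" and log_convex: "\<And>j. (v (Suc j))\<^sup>2 \<le> v j * v (Suc (Suc j))"
  shows "v 1 * v j \<le> v 0 * v (Suc j)"
proof (induction j)
  case (Suc j)
  show ?case
  proof (cases "v j = 0")
    case True
    then show ?thesis using log_convex[of j] nonneg[of 0] nonneg[of "Suc (Suc j)"] by simp
  next
    case False
    then have "0 < v j" using nonneg[of j] by simp
    have "v j * (v 1 * v (Suc j)) \<le> v 0 * (v (Suc j))\<^sup>2"
      using mult_right_mono[OF Suc.IH nonneg[of "Suc j"]] by (simp add: power2_eq_square mult_ac)
    also have "\<dots> \<le> v 0 * (v j * v (Suc (Suc j)))" using log_convex nonneg by (intro mult_left_mono)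
    finally have "v j * (v 1 * v (Suc j)) \<le> v j * (v 0 * v (Suc (Suc j)))" by (simp add: mult_ac)
    then show ?thesis using \<open>0 < v j\<close> by simp
  qed
qed (simp add: mult.commute)

lemma log_convex_decay_bound:
  fixes v :: "nat \<Rightarrow> real"
  assumes nonneg: "\<And>j. 0 \<le> v j" and log_convex: "\<And>j. (v (Suc j))\<^sup>2 \<le> v j * v (Suc (Suc j))"
    and s_pos: "0 < s" and decay: "\<And>j. v (Suc j) \<le> C * s ^ j"
  shows "v 1 \<le> s * v 0"
proof (rule ccontr)
  assume "\<not> ?thesis"
  then have v1_gt: "s * v 0 < v 1" by simp
  then have v1_pos: "0 < v 1" using s_pos nonneg[of 0] by (smt (verit) mult_nonneg_nonneg)
  then have v0_pos: "0 < v 0"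
    using log_convex[of 0] nonneg[of 0] by (cases "v 0 = 0") auto
  define q where "q = v 1 / (s * v 0)"
  have q_gt_1: "1 < q" using v1_gt s_pos v0_pos by (simp add: q_def)
  have growth: "(q * s) ^ j * v 1 \<le> v (Suc j)" for j
  proof (induction j)
    case (Suc j)
    have "(q * s) ^ Suc j * v 1 \<le> (q * s) * v (Suc j)"
      using mult_left_mono[OF Suc.IH, of "q * s"] q_gt_1 s_pos by (simp add: mult.assoc)
    also have "\<dots> \<le> v (Suc (Suc j))"
      using log_convex_ratio_le[of v "Suc j", OF nonneg log_convex] s_pos v0_pos
      by (simp add: q_def field_simps)
    finally show ?case .
  qed simp
  have "q ^ j \<le> C / v 1" for j
    using order_trans[OF growth[of j] decay[of j]] s_pos v1_pos
    by (simp add: power_mult_distrib field_simps)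
  moreover obtain j where "C / v 1 < q ^ j" using real_arch_pow[OF q_gt_1] by blast
  ultimately show False by (meson not_less)
qed

context prob_space
begin

lemma integrable_bounded_measurable: "bounded_measurable M f \<Longrightarrow> integrable M f"
  using bounded_measurable_integrable[OF _ prob_space_axioms refl] .

lemma square_integrable_integrable: "square_integrable M f \<Longrightarrow> integrable M f"
  by (auto simp: square_integrable_def intro: square_integrable_imp_integrable)

lemma bounded_measurable_square_integrable: "bounded_measurable M f \<Longrightarrow> square_integrable M f"
  using integrable_bounded_measurable[OF bounded_measurable_arith(1)[of M f f]]
  by (auto simp: square_integrable_def bounded_measurable_def power2_eq_square)

lemma variance_square_integrable:
  "square_integrable M f \<Longrightarrow> variance f = expectation (\<lambda>x. (f x)\<^sup>2) - (expectation f)\<^sup>2"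
  using variance_eq[OF square_integrable_integrable] by (simp add: square_integrable_def)

lemma variance_le_second_moment:
  assumes "square_integrable M f"
  shows "variance f \<le> expectation (\<lambda>x. (f x - c)\<^sup>2)"
proof -
  have f: "integrable M f" "integrable M (\<lambda>x. (f x)\<^sup>2)"
    using assms square_integrable_integrable[OF assms] by (simp_all add: square_integrable_def)
  have "expectation (\<lambda>x. (f x - c)\<^sup>2) = expectation (\<lambda>x. (f x)\<^sup>2) - 2 * c * expectation f + c\<^sup>2"
    using f by (simp add: power2_diff prob_space algebra_simps)
  moreover have "0 \<le> (expectation f - c)\<^sup>2" by simp
  ultimately show ?thesis
    unfolding variance_square_integrable[OF assms] by (simp add: power2_diff algebra_simps)
qed

end

locale stationary_kernel = prob_space M for M :: "'a measure" +
  fixes K :: "'a \<Rightarrow> 'a measure"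
  assumes kernel: "K \<in> M \<rightarrow>\<^sub>M prob_algebra M" and stationary: "M \<bind> K = M"
begin

lemma AE_integrable_kernel: "integrable M f \<Longrightarrow> AE x in M. integrable (K x) f" for f :: "'a \<Rightarrow> real"
  using AE_integrable_bind(1)[OF measurable_prob_algebraD[OF kernel] not_empty]
  unfolding stationary .

lemma integrable_kernel_op: "integrable M f \<Longrightarrow> integrable M (kernel_op K f)"
  using integral_bind_integrable(1)[OF kernel prob_space_axioms]
  unfolding stationary kernel_op_def[abs_def] .

lemma expectation_kernel_op: "integrable M f \<Longrightarrow> expectation (kernel_op K f) = expectation f"
  using integral_bind_integrable(2)[OF kernel prob_space_axioms]
  unfolding stationary kernel_op_def[abs_def] by simp

lemma kernel_op_power2_le:
  assumes f: "square_integrable M f"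
  shows "AE x in M. (kernel_op K f x)\<^sup>2 \<le> kernel_op K (\<lambda>y. (f y)\<^sup>2) x"
proof -
  have "integrable M (\<lambda>x. (f x)\<^sup>2)" using f by (simp add: square_integrable_def)
  from AE_integrable_kernel[OF this] AE_integrable_kernel[OF square_integrable_integrable[OF f]] AE_space
  show ?thesis
  proof eventually_elim
    case (elim x)
    interpret Kx: prob_space "K x" using markov_kernelD[OF kernel] elim by simp
    have "0 \<le> Kx.variance f" by simp
    then show ?case using elim by (simp add: Kx.variance_eq kernel_op_def)
  qed
qed

lemma square_integrable_kernel_op:
  assumes f: "square_integrable M f"
  shows "square_integrable M (kernel_op K f)"
  unfolding square_integrable_def
proof
  have int_square: "integrable M (\<lambda>x. (f x)\<^sup>2)" and [measurable]: "f \<in> borel_measurable M"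
    using f by (auto simp: square_integrable_def)
  show [measurable]: "kernel_op K f \<in> borel_measurable M"
    using kernel by (rule kernel_op_measurable) measurable
  show "integrable M (\<lambda>x. (kernel_op K f x)\<^sup>2)"
  proof (rule Bochner_Integration.integrable_bound[OF integrable_kernel_op[OF int_square]])
    show "AE x in M. norm ((kernel_op K f x)\<^sup>2) \<le> norm (kernel_op K (\<lambda>y. (f y)\<^sup>2) x)"
      using kernel_op_power2_le[OF f] by eventually_elim simp
  qed measurable
qed

lemma tendsto_second_moment_kernel_op_clip:
  assumes f: "square_integrable M f"
  shows "(\<lambda>n. expectation (\<lambda>x. (kernel_op K (\<lambda>y. clip n (f y)) x)\<^sup>2)) \<longlonglongrightarrow> expectation (\<lambda>x. (kernel_op K f x)\<^sup>2)"
proof (rule integral_dominated_convergence)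
  have [measurable]: "f \<in> borel_measurable M" and int_square: "integrable M (\<lambda>x. (f x)\<^sup>2)"
    using f by (auto simp: square_integrable_def)
  note [measurable] = kernel_op_measurable[OF kernel]
  show "(\<lambda>x. (kernel_op K f x)\<^sup>2) \<in> borel_measurable M"
    "(\<lambda>x. (kernel_op K (\<lambda>y. clip n (f y)) x)\<^sup>2) \<in> borel_measurable M" for n by measurable
  show "integrable M (kernel_op K (\<lambda>y. (f y)\<^sup>2))" using int_square by (rule integrable_kernel_op)
  show "AE x in M. (\<lambda>n. (kernel_op K (\<lambda>y. clip n (f y)) x)\<^sup>2) \<longlonglongrightarrow> (kernel_op K f x)\<^sup>2"
    using AE_integrable_kernel[OF square_integrable_integrable[OF f]] AE_space
  proof eventually_elim
    case (elim x)
    then have "(\<lambda>n. kernel_op K (\<lambda>y. clip n (f y)) x) \<longlonglongrightarrow> kernel_op K f x"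
      unfolding kernel_op_def using markov_kernelD[OF kernel elim(2)] abs_clip_le(2) clip_tendsto
      by (intro integral_dominated_convergence[where w="\<lambda>y. \<bar>f y\<bar>"]) auto
    then show ?case by (rule tendsto_power)
  qed
  fix n
  have "AE x in M. (kernel_op K (\<lambda>y. clip n (f y)) x)\<^sup>2 \<le> kernel_op K (\<lambda>y. (clip n (f y))\<^sup>2) x"
    by (intro kernel_op_power2_le bounded_measurable_square_integrable bounded_measurable_clip) measurable
  then show "AE x in M. norm ((kernel_op K (\<lambda>y. clip n (f y)) x)\<^sup>2) \<le> kernel_op K (\<lambda>y. (f y)\<^sup>2) x"
    using AE_integrable_kernel[OF int_square]
  proof eventually_elim
    case (elim x)
    have "kernel_op K (\<lambda>y. (clip n (f y))\<^sup>2) x \<le> kernel_op K (\<lambda>y. (f y)\<^sup>2) x"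
      unfolding kernel_op_def using elim(2) abs_clip_le(2)
      by (intro integral_mono') (auto simp: abs_le_square_iff[symmetric])
    then show ?case using elim(1) by simp
  qed
qed

lemma variance_contraction_square_integrable:
  assumes contraction: "\<And>g. bounded_measurable M g \<Longrightarrow> variance (kernel_op K g) \<le> r * variance g"
    and f: "square_integrable M f"
  shows "variance (kernel_op K f) \<le> r * variance f"
proof -
  have [measurable]: "f \<in> borel_measurable M" and int_square: "integrable M (\<lambda>x. (f x)\<^sup>2)"
    using f by (auto simp: square_integrable_def)
  define g where "g n x = clip n (f x)" for n x
  have bounded_g: "bounded_measurable M (g n)" for n
    unfolding g_def by (intro bounded_measurable_clip) measurable
  have variance_op: "variance (kernel_op K h) = expectation (\<lambda>x. (kernel_op K h x)\<^sup>2) - (expectation h)\<^sup>2"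
    if "square_integrable M h" for h
    using variance_square_integrable[OF square_integrable_kernel_op[OF that]]
      expectation_kernel_op[OF square_integrable_integrable[OF that]] by simp
  have mean: "(\<lambda>n. expectation (g n)) \<longlonglongrightarrow> expectation f"
    unfolding g_def using square_integrable_integrable[OF f] abs_clip_le(2) clip_tendsto
    by (intro integral_dominated_convergence[where w="\<lambda>x. \<bar>f x\<bar>"]) auto
  have second: "(\<lambda>n. expectation (\<lambda>x. (g n x)\<^sup>2)) \<longlonglongrightarrow> expectation (\<lambda>x. (f x)\<^sup>2)"
    unfolding g_def using int_square abs_clip_le(2)
    by (intro integral_dominated_convergence[where w="\<lambda>x. (f x)\<^sup>2"])
      (auto intro!: tendsto_power clip_tendsto simp: abs_le_square_iff[symmetric])
  have "(\<lambda>n. variance (kernel_op K (g n))) \<longlonglongrightarrow> variance (kernel_op K f)"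
    unfolding variance_op[OF f] variance_op[OF bounded_measurable_square_integrable[OF bounded_g]]
    using tendsto_second_moment_kernel_op_clip[OF f] mean
    by (intro tendsto_diff tendsto_power) (simp_all add: g_def[abs_def])
  moreover have "(\<lambda>n. r * variance (g n)) \<longlonglongrightarrow> r * variance f"
    unfolding variance_square_integrable[OF f]
      variance_square_integrable[OF bounded_measurable_square_integrable[OF bounded_g]]
    using second mean by (intro tendsto_mult tendsto_const tendsto_diff tendsto_power)
  ultimately show ?thesis using contraction[OF bounded_g] by (intro LIMSEQ_le) auto
qed

end

lemma stationary_kernel_return: "prob_space M \<Longrightarrow> stationary_kernel M (return M)"
  by (simp add: stationary_kernel_def stationary_kernel_axioms_def measurable_return_prob_space bind_return'')

lemma stationary_kernel_bind:
  assumes "stationary_kernel M K" "stationary_kernel M L"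
  shows "stationary_kernel M (\<lambda>x. K x \<bind> L)"
proof -
  interpret K: stationary_kernel M K by fact
  interpret L: stationary_kernel M L by fact
  have "M \<bind> (\<lambda>x. K x \<bind> L) = (M \<bind> K) \<bind> L"
    using bind_assoc[OF measurable_prob_algebraD[OF K.kernel] measurable_prob_algebraD[OF L.kernel]]
    by simp
  then show ?thesis
    using measurable_bind_prob_space[OF K.kernel L.kernel] K.stationary L.stationary
    by unfold_locales simp_all
qed

lemma reversible_kernel_stationary:
  assumes K: "reversible_kernel M K" and M: "prob_space M"
  shows "stationary_kernel M K"
proof -
  interpret prob_space M by fact
  note kernel = reversible_kernelD(1)[OF K]
  have "M \<bind> K = M"
  proof (rule measure_eqI)
    show sets: "sets (M \<bind> K) = sets M"
      using markov_kernelD(2)[OF kernel] not_empty by (rule sets_bind)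
    fix A assume "A \<in> sets (M \<bind> K)"
    then have A: "A \<in> sets M" by (simp add: sets)
    then have "(\<integral>\<^sup>+x. 1 * (\<integral>\<^sup>+y. indicator A y \<partial>K x) \<partial>M) = (\<integral>\<^sup>+x. indicator A x * (\<integral>\<^sup>+y. 1 \<partial>K x) \<partial>M)"
      by (intro reversible_kernelD(2)[OF K]) auto
    also have "\<dots> = (\<integral>\<^sup>+x. indicator A x \<partial>M)"
      by (intro nn_integral_cong) (auto simp: prob_space.emeasure_space_1[OF markov_kernelD(1)[OF kernel]])
    finally have "(\<integral>\<^sup>+x. emeasure (K x) A \<partial>M) = emeasure M A"
      using A markov_kernelD(2)[OF kernel] by (simp cong: nn_integral_cong)
    then show "emeasure (M \<bind> K) A = emeasure M A"
      using emeasure_bind[OF not_empty measurable_prob_algebraD[OF kernel] A] by simp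
  qed
  then show ?thesis using kernel by unfold_locales
qed

context prob_space
begin

lemma nn_integral_mult_kernel:
  assumes K: "K \<in> M \<rightarrow>\<^sub>M prob_algebra M"
    and f: "bounded_measurable M f" "\<And>x. x \<in> space M \<Longrightarrow> 0 \<le> f x"
    and g: "bounded_measurable M g" "\<And>x. x \<in> space M \<Longrightarrow> 0 \<le> g x"
  shows "(\<integral>\<^sup>+x. ennreal (g x) * (\<integral>\<^sup>+y. ennreal (f y) \<partial>K x) \<partial>M)
      = ennreal (expectation (\<lambda>x. g x * kernel_op K f x))"
    and "0 \<le> expectation (\<lambda>x. g x * kernel_op K f x)"
proof -
  have Kf: "(\<integral>\<^sup>+y. ennreal (f y) \<partial>K x) = ennreal (kernel_op K f x)" "0 \<le> kernel_op K f x"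
    if x: "x \<in> space M" for x
  proof -
    have "AE y in K x. 0 \<le> f y" using f(2) markov_kernelD[OF K x] by (intro AE_I2) auto
    then show "(\<integral>\<^sup>+y. ennreal (f y) \<partial>K x) = ennreal (kernel_op K f x)" "0 \<le> kernel_op K f x"
      using bounded_measurable_integrable[OF f(1)] markov_kernelD[OF K x]
      by (auto simp: kernel_op_def nn_integral_eq_integral intro: integral_nonneg_AE)
  qed
  then have nonneg: "AE x in M. 0 \<le> g x * kernel_op K f x" using g(2) by (intro AE_I2) auto
  have "(\<integral>\<^sup>+x. ennreal (g x) * (\<integral>\<^sup>+y. ennreal (f y) \<partial>K x) \<partial>M) = (\<integral>\<^sup>+x. ennreal (g x * kernel_op K f x) \<partial>M)"
    using Kf g(2) by (intro nn_integral_cong) (simp add: ennreal_mult)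
  also have "\<dots> = ennreal (expectation (\<lambda>x. g x * kernel_op K f x))"
    using bounded_measurable_kernel_op[OF K f(1)] g(1) nonneg
    by (intro nn_integral_eq_integral integrable_bounded_measurable bounded_measurable_arith)
  finally show "(\<integral>\<^sup>+x. ennreal (g x) * (\<integral>\<^sup>+y. ennreal (f y) \<partial>K x) \<partial>M)
      = ennreal (expectation (\<lambda>x. g x * kernel_op K f x))" .
  show "0 \<le> expectation (\<lambda>x. g x * kernel_op K f x)" using nonneg by (rule integral_nonneg_AE)
qed

lemma reversible_kernel_symmetric_nonneg:
  assumes K: "reversible_kernel M K"
    and f: "bounded_measurable M f" "\<And>x. x \<in> space M \<Longrightarrow> 0 \<le> f x"
    and g: "bounded_measurable M g" "\<And>x. x \<in> space M \<Longrightarrow> 0 \<le> g x"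
  shows "expectation (\<lambda>x. g x * kernel_op K f x) = expectation (\<lambda>x. f x * kernel_op K g x)"
proof -
  have "(\<integral>\<^sup>+x. ennreal (g x) * (\<integral>\<^sup>+y. ennreal (f y) \<partial>K x) \<partial>M)
      = (\<integral>\<^sup>+x. ennreal (f x) * (\<integral>\<^sup>+y. ennreal (g y) \<partial>K x) \<partial>M)"
    using f(1) g(1) by (intro reversible_kernelD(2)[OF K]) (auto simp: bounded_measurable_def)
  then show ?thesis
    using nn_integral_mult_kernel[OF reversible_kernelD(1)[OF K] f g]
      nn_integral_mult_kernel[OF reversible_kernelD(1)[OF K] g f] by simp
qed

lemma reversible_kernel_symmetric:
  assumes K: "reversible_kernel M K" and f: "bounded_measurable M f" and g: "bounded_measurable M g"
  shows "expectation (\<lambda>x. g x * kernel_op K f x) = expectation (\<lambda>x. f x * kernel_op K g x)"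
proof -
  interpret stationary_kernel M K using K prob_space_axioms by (rule reversible_kernel_stationary)
  obtain B where f_le: "\<And>x. x \<in> space M \<Longrightarrow> \<bar>f x\<bar> \<le> B" using bounded_measurableE[OF f] by blast
  obtain C where g_le: "\<And>x. x \<in> space M \<Longrightarrow> \<bar>g x\<bar> \<le> C" using bounded_measurableE[OF g] by blast
  have shift: "expectation (\<lambda>x. (v x + c) * kernel_op K (\<lambda>y. u y + b) x) =
      expectation (\<lambda>x. v x * kernel_op K u x) + c * expectation u + b * expectation v + b * c"
    if u: "bounded_measurable M u" and v: "bounded_measurable M v" for u v b c
  proof -
    note Ku = bounded_measurable_kernel_op[OF kernel u]
    have "expectation (\<lambda>x. (v x + c) * kernel_op K (\<lambda>y. u y + b) x) =
        expectation (\<lambda>x. v x * kernel_op K u x + c * kernel_op K u x + b * v x + b * c)"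
      by (intro Bochner_Integration.integral_cong refl)
        (subst kernel_op_add_const[OF kernel u], auto simp: algebra_simps)
    also have "\<dots> = expectation (\<lambda>x. v x * kernel_op K u x) + c * expectation (kernel_op K u)
        + b * expectation v + b * c"
      using bounded_measurable_arith(1)[OF v Ku, THEN integrable_bounded_measurable]
        Ku[THEN integrable_bounded_measurable] v[THEN integrable_bounded_measurable]
      by (simp add: prob_space)
    finally show ?thesis by (simp add: expectation_kernel_op integrable_bounded_measurable[OF u])
  qed
  have "expectation (\<lambda>x. (g x + C) * kernel_op K (\<lambda>y. f y + B) x)
      = expectation (\<lambda>x. (f x + B) * kernel_op K (\<lambda>y. g y + C) x)"
  proof (rule reversible_kernel_symmetric_nonneg[OF K])
    show "bounded_measurable M (\<lambda>y. f y + B)" "bounded_measurable M (\<lambda>y. g y + C)"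
      by (intro bounded_measurable_arith bounded_measurable_const f g)+
    show "0 \<le> f x + B" "0 \<le> g x + C" if "x \<in> space M" for x
      using f_le[OF that] g_le[OF that] by auto
  qed
  then show ?thesis unfolding shift[OF f g] shift[OF g f] by (simp add: mult.commute)
qed

lemma bounded_measurable_kernel_ops:
  assumes "\<forall>K\<in>set Ks. reversible_kernel M K" "bounded_measurable M f"
  shows "bounded_measurable M (kernel_ops Ks f)"
  using assms
  by (induction Ks) (simp_all add: bounded_measurable_kernel_op[OF reversible_kernelD(1)])

lemma expectation_kernel_ops:
  assumes "\<forall>K\<in>set Ks. reversible_kernel M K" "bounded_measurable M f"
  shows "expectation (kernel_ops Ks f) = expectation f"
  using assms
proof (induction Ks)
  case (Cons K Ks)
  then interpret stationary_kernel M K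
    by (intro reversible_kernel_stationary prob_space_axioms) simp
  show ?case using Cons expectation_kernel_op[OF integrable_bounded_measurable]
    by (simp add: bounded_measurable_kernel_ops)
qed simp

lemma kernel_ops_adjoint:
  assumes "\<forall>K\<in>set Ks. reversible_kernel M K" "bounded_measurable M f" "bounded_measurable M g"
  shows "expectation (\<lambda>x. g x * kernel_ops Ks f x) = expectation (\<lambda>x. kernel_ops (rev Ks) g x * f x)"
  using assms
proof (induction Ks arbitrary: g)
  case (Cons K Ks)
  have K: "reversible_kernel M K" using Cons by simp
  have "expectation (\<lambda>x. g x * kernel_ops (K # Ks) f x) = expectation (\<lambda>x. kernel_op K g x * kernel_ops Ks f x)"
    using Cons.prems reversible_kernel_symmetric[OF K, of "kernel_ops Ks f" g]
    by (simp add: bounded_measurable_kernel_ops mult.commute)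
  also have "\<dots> = expectation (\<lambda>x. kernel_ops (rev Ks) (kernel_op K g) x * f x)"
    using Cons.prems
    by (intro Cons.IH) (simp_all add: bounded_measurable_kernel_op[OF reversible_kernelD(1)])
  finally show ?case by (simp add: kernel_ops_append)
qed simp

lemma second_moment_iterates_log_convex:
  assumes bounded_Q: "\<And>g. bounded_measurable M g \<Longrightarrow> bounded_measurable M (Q g)"
    and symmetric: "\<And>g h. bounded_measurable M g \<Longrightarrow> bounded_measurable M h \<Longrightarrow>
      expectation (\<lambda>x. g x * Q h x) = expectation (\<lambda>x. Q g x * h x)"
    and f: "bounded_measurable M f"
  defines "v \<equiv> (\<lambda>j. expectation (\<lambda>x. ((Q ^^ j) f x)\<^sup>2))"
  shows "(v (Suc j))\<^sup>2 \<le> v j * v (Suc (Suc j))"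
proof -
  have bounded_iterates: "bounded_measurable M ((Q ^^ j) f)" for j
    by (induction j) (auto intro: f bounded_Q)
  have "v (Suc j) = expectation (\<lambda>x. Q ((Q ^^ j) f) x * (Q ^^ Suc j) f x)"
    by (simp add: v_def power2_eq_square)
  also have "\<dots> = expectation (\<lambda>x. (Q ^^ j) f x * (Q ^^ Suc (Suc j)) f x)"
    using symmetric[OF bounded_iterates[of j] bounded_iterates[of "Suc j"]] by simp
  finally show ?thesis
    using Cauchy_Schwarz_integral(2)[OF bounded_iterates[of j, THEN bounded_measurable_square_integrable]
        bounded_iterates[of "Suc (Suc j)", THEN bounded_measurable_square_integrable]] by (simp add: v_def)
qed

text \<open>With \<open>P\<close> the operator of the sweep and \<open>Q = P\<^sup>* P\<close>, self-adjointness makes \<open>\<parallel>Q\<^sup>j f\<parallel>\<^sup>2\<close> log-convex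
  in \<open>j\<close>, so that its asymptotic rate of decay already bounds the first step.\<close>

lemma kernel_ops_contraction:
  assumes Ks: "\<forall>K\<in>set Ks. reversible_kernel M K" and f: "bounded_measurable M f" and r_pos: "0 < r"
    and decay: "\<And>j. expectation (\<lambda>x. ((kernel_ops (rev Ks @ Ks) ^^ Suc j) f x)\<^sup>2) \<le> C * (r\<^sup>2) ^ j"
  shows "expectation (\<lambda>x. (kernel_ops Ks f x)\<^sup>2) \<le> r * expectation (\<lambda>x. (f x)\<^sup>2)"
proof -
  define Q where "Q = kernel_ops (rev Ks @ Ks)"
  define v where "v j = expectation (\<lambda>x. ((Q ^^ j) f x)\<^sup>2)" for j
  have reversible: "\<forall>K\<in>set (rev Ks @ Ks). reversible_kernel M K" using Ks by auto
  have bounded_Q: "bounded_measurable M (Q g)" if "bounded_measurable M g" for g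
    unfolding Q_def using reversible that by (rule bounded_measurable_kernel_ops)
  have "expectation (\<lambda>x. g x * Q h x) = expectation (\<lambda>x. Q g x * h x)"
    if "bounded_measurable M g" "bounded_measurable M h" for g h
    using kernel_ops_adjoint[OF reversible that(2,1)] by (simp add: Q_def)
  then have "(v (Suc j))\<^sup>2 \<le> v j * v (Suc (Suc j))" for j
    unfolding v_def using bounded_Q f by (intro second_moment_iterates_log_convex)
  then have first_step: "v 1 \<le> r\<^sup>2 * v 0"
    using decay r_pos by (intro log_convex_decay_bound[where C=C]) (simp_all add: v_def Q_def)
  have "expectation (\<lambda>x. (kernel_ops Ks f x)\<^sup>2) = expectation (\<lambda>x. Q f x * f x)"
    using kernel_ops_adjoint[OF Ks f bounded_measurable_kernel_ops[OF Ks f]]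
    by (simp add: power2_eq_square Q_def kernel_ops_append)
  also have "\<dots> \<le> sqrt ((expectation (\<lambda>x. Q f x * f x))\<^sup>2)" by simp
  also have "\<dots> \<le> sqrt (v 1 * v 0)"
    using Cauchy_Schwarz_integral(2)[OF bounded_Q[OF f, THEN bounded_measurable_square_integrable]
        f[THEN bounded_measurable_square_integrable]]
    by (intro real_sqrt_le_mono) (simp add: v_def)
  also have "\<dots> \<le> sqrt (r\<^sup>2 * v 0 * v 0)"
    using first_step by (intro real_sqrt_le_mono mult_right_mono) (auto simp: v_def)
  also have "\<dots> = r * v 0"
    using r_pos by (simp add: real_sqrt_mult v_def)
  finally show ?thesis by (simp add: v_def)
qed

end

subsection \<open>The rate of convergence\<close>

context stationary_kernel
begin

lemma stationary_kernel_pow: "stationary_kernel M (kernel_pow M K n)"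
proof (induction n)
  case 0
  have "kernel_pow M K 0 = return M" by (rule ext) simp
  then show ?case using stationary_kernel_return[OF prob_space_axioms] by simp
next
  case (Suc n)
  have "kernel_pow M K (Suc n) = (\<lambda>x. kernel_pow M K n x \<bind> K)" by (rule ext) simp
  then show ?case using stationary_kernel_bind[OF Suc stationary_kernel_axioms] by simp
qed

lemma kernel_apply_Suc:
  assumes f: "integrable M f"
  shows "AE x in M. kernel_apply M K (Suc n) f x = kernel_apply M K n (kernel_op K f) x"
proof -
  interpret pow: stationary_kernel M "kernel_pow M K n" by (rule stationary_kernel_pow)
  interpret pow_Suc: stationary_kernel M "kernel_pow M K (Suc n)" by (rule stationary_kernel_pow)
  show ?thesis using pow_Suc.AE_integrable_kernel[OF f] AE_space
  proof eventually_elim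
    case (elim x)
    note powx = markov_kernelD[OF pow.kernel elim(2)]
    have "K \<in> kernel_pow M K n x \<rightarrow>\<^sub>M prob_algebra M" using kernel by (simp add: powx(4))
    then show ?case
      using integral_bind_integrable(2)[of K "kernel_pow M K n x" M f] elim(1) powx(1)
      by (simp add: kernel_apply_def kernel_op_def)
  qed
qed

lemma kernel_apply_decay:
  assumes r_nonneg: "0 \<le> r"
    and contraction: "\<And>f. square_integrable M f \<Longrightarrow> variance (kernel_op K f) \<le> r * variance f"
    and f: "square_integrable M f"
  shows "(\<integral>\<^sup>+x. ennreal ((kernel_apply M K n f x - expectation f)\<^sup>2) \<partial>M) \<le> ennreal (r ^ n * variance f)"
  using f
proof (induction n arbitrary: f)
  case 0
  then have f: "f \<in> borel_measurable M" and int: "integrable M f" "integrable M (\<lambda>x. (f x)\<^sup>2)"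
    using square_integrable_integrable[OF 0] by (auto simp: square_integrable_def)
  have "(\<integral>\<^sup>+x. ennreal ((kernel_apply M K 0 f x - expectation f)\<^sup>2) \<partial>M)
    = (\<integral>\<^sup>+x. ennreal ((f x - expectation f)\<^sup>2) \<partial>M)"
    using f by (intro nn_integral_cong) (simp add: kernel_apply_def integral_return)
  also have "\<dots> = ennreal (variance f)"
  proof (rule nn_integral_eq_integral)
    show "integrable M (\<lambda>x. (f x - expectation f)\<^sup>2)" using int by (simp add: power2_diff)
  qed simp
  finally show ?case by simp
next
  case (Suc n)
  note int = square_integrable_integrable[OF Suc.prems]
  have "(\<integral>\<^sup>+x. ennreal ((kernel_apply M K (Suc n) f x - expectation f)\<^sup>2) \<partial>M)
    = (\<integral>\<^sup>+x. ennreal ((kernel_apply M K n (kernel_op K f) x - expectation (kernel_op K f))\<^sup>2) \<partial>M)"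
  proof (rule nn_integral_cong_AE)
    show "AE x in M. ennreal ((kernel_apply M K (Suc n) f x - expectation f)\<^sup>2)
        = ennreal ((kernel_apply M K n (kernel_op K f) x - expectation (kernel_op K f))\<^sup>2)"
      using kernel_apply_Suc[OF int, of n]
      by eventually_elim (simp only: expectation_kernel_op[OF int])
  qed
  also have "\<dots> \<le> ennreal (r ^ n * variance (kernel_op K f))"
    by (rule Suc.IH[OF square_integrable_kernel_op[OF Suc.prems]])
  also have "\<dots> \<le> ennreal (r ^ n * (r * variance f))"
    using contraction[OF Suc.prems] r_nonneg by (intro ennreal_leI mult_left_mono) auto
  finally show ?case by (simp add: mult_ac)
qed

lemma l2_rate_ok_variance_contraction:
  assumes r_nonneg: "0 \<le> r"
    and contraction: "\<And>f. square_integrable M f \<Longrightarrow> variance (kernel_op K f) \<le> r * variance f"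
  shows "l2_rate_ok M K r"
  unfolding l2_rate_ok_def
proof (intro allI impI)
  fix f :: "'a \<Rightarrow> real" and r'
  assume "f \<in> borel_measurable M \<and> integrable M (\<lambda>x. (f x)\<^sup>2)" and r': "r < r'"
  then have f: "square_integrable M f" by (simp add: square_integrable_def)
  have variance_nonneg: "0 \<le> variance f" by simp
  show "\<exists>V>0. \<forall>n. 0 \<le> V * r' ^ n \<and>
      (\<integral>\<^sup>+x. ennreal ((kernel_apply M K n f x - expectation f)\<^sup>2) \<partial>M) \<le> ennreal (V * r' ^ n)"
  proof (intro exI[of _ "variance f + 1"] conjI allI)
    fix n
    show "0 \<le> (variance f + 1) * r' ^ n" using variance_nonneg r_nonneg r' by simp
    have "r ^ n * variance f \<le> (variance f + 1) * r' ^ n"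
      using variance_nonneg r_nonneg r' by (subst mult.commute, intro mult_mono power_mono) auto
    then show "(\<integral>\<^sup>+x. ennreal ((kernel_apply M K n f x - expectation f)\<^sup>2) \<partial>M)
        \<le> ennreal ((variance f + 1) * r' ^ n)"
      using kernel_apply_decay[OF r_nonneg contraction f, of n] by (meson ennreal_leI order_trans)
  qed (use variance_nonneg in linarith)
qed

end

lemma l2_rate_ok_nonneg:
  assumes "l2_rate_ok M K \<rho>"
  shows "0 \<le> \<rho>"
proof (rule ccontr)
  assume "\<not> 0 \<le> \<rho>"
  then have "\<rho> < \<rho> / 2" "\<rho> / 2 < 0" by auto
  moreover have "(\<lambda>_. 0::real) \<in> borel_measurable M \<and> integrable M (\<lambda>_. (0::real)\<^sup>2)" by simp
  ultimately obtain V where "0 < V" "\<forall>n. 0 \<le> V * (\<rho> / 2) ^ n"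
    using assms unfolding l2_rate_ok_def by blast
  then show False using \<open>\<rho> / 2 < 0\<close> by (auto simp: zero_le_mult_iff dest: spec[of _ 1])
qed

lemma l2_rate_bounds:
  assumes "l2_rate_ok M K r"
  shows "0 \<le> l2_rate M K" "l2_rate M K \<le> r"
  unfolding l2_rate_def using assms l2_rate_ok_nonneg
  by (auto intro!: cInf_greatest cInf_lower bdd_belowI[of _ 0])

subsection \<open>Normal laws and Gibbs updates on product spaces\<close>

abbreviation block_space :: "'i set \<Rightarrow> ('i \<Rightarrow> real) measure" where
  "block_space A \<equiv> Pi\<^sub>M A (\<lambda>_. lborel)"

abbreviation replace_block :: "nat \<Rightarrow> nat set \<Rightarrow> (nat \<Rightarrow> real) \<Rightarrow> (nat \<Rightarrow> real) \<Rightarrow> nat \<Rightarrow> real" where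
  "replace_block m A y x \<equiv> merge A ({1..m} - A) (y, x)"

lemma PiM_density_prod:
  fixes f :: "'i \<Rightarrow> 'a \<Rightarrow> real"
  assumes A: "finite A" and M: "\<And>i. sigma_finite_measure (M i)"
    and f[measurable]: "\<And>i. f i \<in> borel_measurable (M i)" and nonneg: "\<And>i x. 0 \<le> f i x"
  shows "density (Pi\<^sub>M A M) (\<lambda>y. ennreal (\<Prod>i\<in>A. f i (y i))) = Pi\<^sub>M A (\<lambda>i. density (M i) (f i))"
proof -
  interpret M: product_sigma_finite M by (simp add: product_sigma_finite_def M)
  have "sigma_finite_measure (density (M i) (f i))" for i
    using sigma_finite_measure.sigma_finite_iff_density_finite[OF M[of i], of "f i"] by simp
  then interpret D: product_sigma_finite "\<lambda>i. density (M i) (f i)"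
    by (simp add: product_sigma_finite_def)
  show ?thesis
  proof (rule D.PiM_eqI[OF A])
    show "sets (density (Pi\<^sub>M A M) (\<lambda>y. ennreal (\<Prod>i\<in>A. f i (y i)))) = sets (Pi\<^sub>M A (\<lambda>i. density (M i) (f i)))"
      by (simp cong: sets_PiM_cong)
    fix B assume "\<And>i. i \<in> A \<Longrightarrow> B i \<in> sets (density (M i) (f i))"
    then have sides: "\<And>i. i \<in> A \<Longrightarrow> B i \<in> sets (M i)" by simp
    then have box: "Pi\<^sub>E A B \<in> sets (Pi\<^sub>M A M)" using A by (intro sets_PiM_I_finite)
    have "(\<lambda>y. f i (y i)) \<in> borel_measurable (Pi\<^sub>M A M)" if "i \<in> A" for i
      using measurable_compose[OF measurable_component_singleton[OF that] f] .
    then have "emeasure (density (Pi\<^sub>M A M) (\<lambda>y. ennreal (\<Prod>i\<in>A. f i (y i)))) (Pi\<^sub>E A B)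
      = (\<integral>\<^sup>+y. ennreal (\<Prod>i\<in>A. f i (y i)) * indicator (Pi\<^sub>E A B) y \<partial>Pi\<^sub>M A M)"
      using box by (intro emeasure_density) auto
    also have "\<dots> = (\<integral>\<^sup>+y. (\<Prod>i\<in>A. ennreal (f i (y i)) * indicator (B i) (y i)) \<partial>Pi\<^sub>M A M)"
    proof (rule nn_integral_cong)
      fix y assume "y \<in> space (Pi\<^sub>M A M)"
      then have "indicator (Pi\<^sub>E A B) y = (\<Prod>i\<in>A. indicator (B i) (y i) :: ennreal)"
        using A
        by (auto simp: indicator_def space_PiM PiE_iff extensional_def
            intro!: prod_zero[symmetric] prod.neutral)
      then show "ennreal (\<Prod>i\<in>A. f i (y i)) * indicator (Pi\<^sub>E A B) y
          = (\<Prod>i\<in>A. ennreal (f i (y i)) * indicator (B i) (y i))"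
        by (simp add: prod.distrib prod_ennreal nonneg)
    qed
    also have "\<dots> = (\<Prod>i\<in>A. \<integral>\<^sup>+t. ennreal (f i t) * indicator (B i) t \<partial>M i)"
      using A sides by (intro M.product_nn_integral_prod) auto
    also have "\<dots> = (\<Prod>i\<in>A. emeasure (density (M i) (f i)) (B i))"
      using sides by (intro prod.cong refl) (simp add: emeasure_density)
    finally show "emeasure (density (Pi\<^sub>M A M) (\<lambda>y. ennreal (\<Prod>i\<in>A. f i (y i)))) (Pi\<^sub>E A B)
      = (\<Prod>i\<in>A. emeasure (density (M i) (f i)) (B i))" .
  qed
qed

lemma distr_PiM_componentwise:
  assumes A: "finite A" and M: "\<And>i. prob_space (M i)" and f[measurable]: "\<And>i. f i \<in> M i \<rightarrow>\<^sub>M N i"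
  shows "distr (Pi\<^sub>M A M) (Pi\<^sub>M A N) (\<lambda>z. \<lambda>i\<in>A. f i (z i)) = Pi\<^sub>M A (\<lambda>i. distr (M i) (N i) (f i))"
proof -
  interpret M: product_sigma_finite M
    by (simp add: product_sigma_finite_def prob_space_imp_sigma_finite M)
  interpret D: product_sigma_finite "\<lambda>i. distr (M i) (N i) (f i)"
    by (simp add: product_sigma_finite_def prob_space_imp_sigma_finite prob_space.prob_space_distr M)
  have map_measurable: "(\<lambda>z. \<lambda>i\<in>A. f i (z i)) \<in> Pi\<^sub>M A M \<rightarrow>\<^sub>M Pi\<^sub>M A N" by measurable
  show ?thesis
  proof (rule D.PiM_eqI[OF A])
    show "sets (distr (Pi\<^sub>M A M) (Pi\<^sub>M A N) (\<lambda>z. \<lambda>i\<in>A. f i (z i)))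
        = sets (Pi\<^sub>M A (\<lambda>i. distr (M i) (N i) (f i)))"
      by (simp cong: sets_PiM_cong)
    fix B assume "\<And>i. i \<in> A \<Longrightarrow> B i \<in> sets (distr (M i) (N i) (f i))"
    then have sides: "\<And>i. i \<in> A \<Longrightarrow> B i \<in> sets (N i)" by simp
    then have box: "Pi\<^sub>E A B \<in> sets (Pi\<^sub>M A N)" using A by (intro sets_PiM_I_finite)
    have "(\<lambda>z. \<lambda>i\<in>A. f i (z i)) -` Pi\<^sub>E A B \<inter> space (Pi\<^sub>M A M) = Pi\<^sub>E A (\<lambda>i. f i -` B i \<inter> space (M i))"
      by (auto simp: space_PiM PiE_iff)
    then have "emeasure (distr (Pi\<^sub>M A M) (Pi\<^sub>M A N) (\<lambda>z. \<lambda>i\<in>A. f i (z i))) (Pi\<^sub>E A B)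
      = (\<Prod>i\<in>A. emeasure (M i) (f i -` B i \<inter> space (M i)))"
      unfolding emeasure_distr[OF map_measurable box]
      using sides by (simp add: M.emeasure_PiM[OF A] measurable_sets[OF f])
    then show "emeasure (distr (Pi\<^sub>M A M) (Pi\<^sub>M A N) (\<lambda>z. \<lambda>i\<in>A. f i (z i))) (Pi\<^sub>E A B)
      = (\<Prod>i\<in>A. emeasure (distr (M i) (N i) (f i)) (B i))"
      using sides by (simp add: emeasure_distr[OF f])
  qed
qed

definition normal_law :: "real \<Rightarrow> real \<Rightarrow> real measure" where
  "normal_law \<mu> s = density lborel (\<lambda>z. ennreal (normal_density \<mu> s z))"

lemma prob_space_normal_law: "0 < s \<Longrightarrow> prob_space (normal_law \<mu> s)"
  unfolding normal_law_def by (rule prob_space_normal_density)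

lemma sets_normal_law[simp, measurable_cong]: "sets (normal_law \<mu> s) = sets borel"
  by (simp add: normal_law_def)

lemma distr_normal_law_translate:
  assumes "0 < s"
  shows "distr (normal_law 0 s) lborel (\<lambda>z. z + \<mu>) = normal_law \<mu> s"
proof -
  interpret prob_space "normal_law 0 s" using assms by (rule prob_space_normal_law)
  have "distr (normal_law 0 s) lborel (\<lambda>z. z) = normal_law 0 s" by (rule distr_id2) simp
  then have "distributed (normal_law 0 s) lborel (\<lambda>z. z) (normal_density 0 s)"
    by (simp add: distributed_def normal_law_def)
  from normal_density_affine[OF this assms, of 1 \<mu>]
  have "distr (normal_law 0 s) lborel (\<lambda>z. \<mu> + z) = density lborel (normal_density \<mu> s)"
    by (simp add: distributed_distr_eq_density)
  then show ?thesis by (simp add: normal_law_def add.commute)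
qed

lemma PiM_normal_law_translate:
  assumes "finite A" "0 < s"
  shows "Pi\<^sub>M A (\<lambda>i. normal_law (\<mu> i) s)
    = distr (Pi\<^sub>M A (\<lambda>_. normal_law 0 s)) (block_space A) (\<lambda>z. \<lambda>i\<in>A. z i + \<mu> i)"
  using distr_PiM_componentwise[OF assms(1), of "\<lambda>_. normal_law 0 s" "\<lambda>i z. z + \<mu> i" "\<lambda>_. lborel"]
    distr_normal_law_translate[OF assms(2)] prob_space_normal_law[OF assms(2)] by simp

lemma L1_dist_le_Hellinger:
  fixes p q :: "'a \<Rightarrow> real"
  assumes p: "integrable M p" "\<And>x. 0 \<le> p x" "(\<integral>x. p x \<partial>M) = 1"
    and q: "integrable M q" "\<And>x. 0 \<le> q x" "(\<integral>x. q x \<partial>M) = 1"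
  shows "(\<integral>x. \<bar>p x - q x\<bar> \<partial>M)\<^sup>2 \<le> 8 * (1 - (\<integral>x. sqrt (p x * q x) \<partial>M))"
proof -
  define u v where "u x = sqrt (p x)" and "v x = sqrt (q x)" for x
  define h where "h = (\<integral>x. sqrt (p x * q x) \<partial>M)"
  have roots: "square_integrable M u" "square_integrable M v"
    using p q by (auto simp: square_integrable_def u_def[abs_def] v_def[abs_def])
  have "integrable M (\<lambda>x. u x * v x)" using Cauchy_Schwarz_integral(1)[OF roots] .
  then have int_root: "integrable M (\<lambda>x. sqrt (p x * q x))"
    by (simp add: u_def v_def real_sqrt_mult)
  have square_diff: "(\<lambda>x. (u x - v x)\<^sup>2) = (\<lambda>x. p x + q x - 2 * sqrt (p x * q x))"
    and square_sum: "(\<lambda>x. (u x + v x)\<^sup>2) = (\<lambda>x. p x + q x + 2 * sqrt (p x * q x))"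
    using p(2) q(2) by (auto simp: u_def v_def power2_diff power2_sum real_sqrt_mult)
  have square_integrable_sum: "square_integrable M (\<lambda>x. \<bar>u x - v x\<bar>)" "square_integrable M (\<lambda>x. u x + v x)"
    using roots p q int_root by (auto simp: square_integrable_def square_diff square_sum)
  have integral_square_diff: "(\<integral>x. (u x - v x)\<^sup>2 \<partial>M) = 2 - 2 * h"
    and integral_square_sum: "(\<integral>x. (u x + v x)\<^sup>2 \<partial>M) = 2 + 2 * h"
    unfolding square_diff square_sum using p q int_root by (simp_all add: h_def)
  have "0 \<le> (\<integral>x. (u x - v x)\<^sup>2 \<partial>M)" by simp
  then have "h \<le> 1" unfolding integral_square_diff by simp
  have "\<bar>p x - q x\<bar> = \<bar>u x - v x\<bar> * (u x + v x)" for x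
  proof -
    have "p x - q x = (u x - v x) * (u x + v x)"
      using p(2) q(2) by (simp add: u_def v_def algebra_simps)
    moreover have "0 \<le> u x + v x" using p(2) q(2) by (simp add: u_def v_def)
    ultimately show ?thesis by (simp add: abs_mult)
  qed
  then have "(\<integral>x. \<bar>p x - q x\<bar> \<partial>M)\<^sup>2 \<le> (2 - 2 * h) * (2 + 2 * h)"
    using Cauchy_Schwarz_integral(2)[OF square_integrable_sum]
    by (simp add: integral_square_diff integral_square_sum)
  also have "\<dots> \<le> (2 - 2 * h) * 4" using \<open>h \<le> 1\<close> by (intro mult_left_mono) auto
  finally show ?thesis by (simp add: h_def)
qed

lemma sqrt_normal_density_mult:
  assumes "0 < s"
  shows "sqrt (normal_density \<mu> s x * normal_density \<nu> s x)
    = exp (- (\<mu> - \<nu>)\<^sup>2 / (8 * s\<^sup>2)) * normal_density ((\<mu> + \<nu>) / 2) s x"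
proof (rule real_sqrt_unique)
  have "2 * (- (\<mu> - \<nu>)\<^sup>2 / (8 * s\<^sup>2)) + 2 * (- (x - (\<mu> + \<nu>) / 2)\<^sup>2 / (2 * s\<^sup>2))
      = - (x - \<mu>)\<^sup>2 / (2 * s\<^sup>2) + - (x - \<nu>)\<^sup>2 / (2 * s\<^sup>2)"
    using assms by (simp add: field_simps power2_eq_square)
  then have "exp (- (\<mu> - \<nu>)\<^sup>2 / (8 * s\<^sup>2)) ^ 2 * exp (- (x - (\<mu> + \<nu>) / 2)\<^sup>2 / (2 * s\<^sup>2)) ^ 2
      = exp (- (x - \<mu>)\<^sup>2 / (2 * s\<^sup>2)) * exp (- (x - \<nu>)\<^sup>2 / (2 * s\<^sup>2))"
    by (simp only: exp_double[symmetric] exp_add[symmetric])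
  then show "(exp (- (\<mu> - \<nu>)\<^sup>2 / (8 * s\<^sup>2)) * normal_density ((\<mu> + \<nu>) / 2) s x)\<^sup>2
      = normal_density \<mu> s x * normal_density \<nu> s x"
    unfolding normal_density_def power_mult_distrib
    by (simp add: power2_eq_square[of "1 / _"] mult_ac)
qed simp

lemma L1_dist_normal_product_le:
  assumes A: "finite A" and s: "0 < s"
  shows "(\<integral>y. \<bar>(\<Prod>i\<in>A. normal_density (\<mu> i) s (y i)) - (\<Prod>i\<in>A. normal_density (\<nu> i) s (y i))\<bar> \<partial>block_space A)
    \<le> L2_set (\<lambda>i. \<mu> i - \<nu> i) A / s"
proof -
  interpret product_sigma_finite "\<lambda>_. lborel :: real measure"
    by (simp add: product_sigma_finite_def lborel.sigma_finite_measure_axioms)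
  define p where "p \<mu> y = (\<Prod>i\<in>A. normal_density (\<mu> i) s (y i))" for \<mu> and y :: "'a \<Rightarrow> real"
  have p: "integrable (block_space A) (p \<mu>)" "(\<integral>y. p \<mu> y \<partial>block_space A) = 1" "\<And>y. 0 \<le> p \<mu> y" for \<mu>
    using s product_integrable_prod[OF A, of "\<lambda>i. normal_density (\<mu> i) s"]
      product_integral_prod[OF A, of "\<lambda>i. normal_density (\<mu> i) s"]
    by (simp_all add: p_def[abs_def] prod_nonneg)
  define t where "t = (\<Sum>i\<in>A. (\<mu> i - \<nu> i)\<^sup>2) / (8 * s\<^sup>2)"
  have "sqrt (p \<mu> y * p \<nu> y) = exp (- t) * p (\<lambda>i. (\<mu> i + \<nu> i) / 2) y" for y
  proof (rule real_sqrt_unique)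
    have "exp (- t) * p (\<lambda>i. (\<mu> i + \<nu> i) / 2) y
        = (\<Prod>i\<in>A. sqrt (normal_density (\<mu> i) s (y i) * normal_density (\<nu> i) s (y i)))"
      unfolding sqrt_normal_density_mult[OF s] prod.distrib exp_sum[OF A, symmetric]
      by (simp add: p_def t_def sum_negf sum_divide_distrib)
    also have "\<dots> ^ 2 = p \<mu> y * p \<nu> y"
      by (simp add: p_def prod_power_distrib prod.distrib)
    finally show "(exp (- t) * p (\<lambda>i. (\<mu> i + \<nu> i) / 2) y)\<^sup>2 = p \<mu> y * p \<nu> y" .
  qed (simp add: p)
  then have "(\<integral>y. sqrt (p \<mu> y * p \<nu> y) \<partial>block_space A) = exp (- t)" by (simp add: p)
  then have "(\<integral>y. \<bar>p \<mu> y - p \<nu> y\<bar> \<partial>block_space A)\<^sup>2 \<le> 8 * (1 - exp (- t))"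
    using L1_dist_le_Hellinger[OF p(1,3,2) p(1,3,2), of \<mu> \<nu>] by simp
  also have "\<dots> \<le> 8 * t" using exp_ge_add_one_self[of "- t"] by simp
  also have "\<dots> = (L2_set (\<lambda>i. \<mu> i - \<nu> i) A / s)\<^sup>2"
    by (simp add: t_def L2_set_def power_divide sum_nonneg)
  finally show ?thesis using s by (auto simp: p_def L2_set_nonneg intro: power2_le_imp_le)
qed

lemma nn_integral_normalised:
  assumes [measurable]: "g \<in> borel_measurable M" "f \<in> borel_measurable M"
  shows "(\<integral>\<^sup>+x. f x \<partial>normalised M g) = (\<integral>\<^sup>+x. ennreal (g x) * f x \<partial>M) / (\<integral>\<^sup>+x. ennreal (g x) \<partial>M)"
proof -
  have "(\<integral>\<^sup>+x. f x \<partial>normalised M g) = (\<integral>\<^sup>+x. ennreal (g x) / (\<integral>\<^sup>+y. ennreal (g y) \<partial>M) * f x \<partial>M)"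
    unfolding normalised_def by (rule nn_integral_density) measurable
  also have "\<dots> = (\<integral>\<^sup>+x. ennreal (g x) * f x / (\<integral>\<^sup>+y. ennreal (g y) \<partial>M) \<partial>M)"
    by (intro nn_integral_cong) (simp add: divide_ennreal_def mult_ac)
  also have "\<dots> = (\<integral>\<^sup>+x. ennreal (g x) * f x \<partial>M) / (\<integral>\<^sup>+x. ennreal (g x) \<partial>M)"
    by (rule nn_integral_divide) measurable
  finally show ?thesis .
qed

lemma prob_space_normalised:
  assumes "g \<in> borel_measurable M" "(\<integral>\<^sup>+x. ennreal (g x) \<partial>M) \<noteq> 0" "(\<integral>\<^sup>+x. ennreal (g x) \<partial>M) < \<infinity>"
  shows "prob_space (normalised M g)"
proof
  have "emeasure (normalised M g) (space (normalised M g)) = (\<integral>\<^sup>+x. 1 \<partial>normalised M g)" by simp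
  also have "\<dots> = 1"
    using assms by (subst nn_integral_normalised) (simp_all add: ennreal_divide_self)
  finally show "emeasure (normalised M g) (space (normalised M g)) = 1" .
qed

lemma normalised_scaled_density:
  assumes c: "0 < c" and f: "f \<in> borel_measurable M" "\<And>x. 0 \<le> f x"
    and one: "(\<integral>\<^sup>+x. ennreal (f x) \<partial>M) = 1"
  shows "normalised M (\<lambda>x. c * f x) = density M f"
proof -
  have "(\<integral>\<^sup>+x. ennreal (c * f x) \<partial>M) = ennreal c"
    using c f one by (simp add: ennreal_mult nn_integral_cmult)
  moreover have "ennreal (c * f x) / ennreal c = ennreal (f x)" for x
    using c f(2)[of x] by (simp add: divide_ennreal)
  ultimately show ?thesis by (simp add: normalised_def)
qed

lemma replace_block_measurable:
  assumes A: "A \<subseteq> {1..m}"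
  shows "(\<lambda>y. replace_block m A y x) \<in> block_space A \<rightarrow>\<^sub>M knot_space m"
proof -
  have union: "A \<union> ({1..m} - A) = {1..m}" using A by auto
  have "restrict x ({1..m} - A) \<in> space (block_space ({1..m} - A))"
    by (simp add: space_PiM)
  then have "(\<lambda>y. replace_block m A y (restrict x ({1..m} - A)))
      \<in> block_space A \<rightarrow>\<^sub>M block_space (A \<union> ({1..m} - A))"
    by (intro measurable_compose[OF _ measurable_merge] measurable_Pair) auto
  moreover have "replace_block m A y (restrict x ({1..m} - A)) = replace_block m A y x" for y
    by (auto simp: merge_def)
  ultimately show ?thesis unfolding union knot_space_def by simp
qed

lemma nn_integral_block_update:
  assumes A: "A \<subseteq> {1..m}" and g: "g \<in> borel_measurable (knot_space m)"
    and f: "f \<in> borel_measurable (knot_space m)"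
  shows "(\<integral>\<^sup>+y. f y \<partial>block_update m g A x)
    = (\<integral>\<^sup>+y. ennreal (g (replace_block m A y x)) * f (replace_block m A y x) \<partial>block_space A)
      / (\<integral>\<^sup>+y. ennreal (g (replace_block m A y x)) \<partial>block_space A)"
proof -
  note [measurable] = replace_block_measurable[OF A, of x] g f
  have "(\<integral>\<^sup>+y. f y \<partial>block_update m g A x) = (\<integral>\<^sup>+y. f (replace_block m A y x)
      \<partial>normalised (block_space A) (\<lambda>y. g (replace_block m A y x)))"
    unfolding block_update_def normalised_def by (intro nn_integral_distr) measurable
  also have "\<dots> = (\<integral>\<^sup>+y. ennreal (g (replace_block m A y x)) * f (replace_block m A y x) \<partial>block_space A)
      / (\<integral>\<^sup>+y. ennreal (g (replace_block m A y x)) \<partial>block_space A)"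
    by (rule nn_integral_normalised) measurable
  finally show ?thesis .
qed

lemma block_update_replace_block:
  "block_update m g A (replace_block m A u v) = block_update m g A v"
proof -
  have "replace_block m A y (replace_block m A u v) = replace_block m A y v" for y
    by (auto simp: merge_def)
  then show ?thesis by (simp add: block_update_def)
qed

text \<open>The right-hand side is symmetric in \<open>f\<close> and \<open>h\<close>, which is the reversibility of the update.\<close>

lemma nn_integral_mult_block_update:
  assumes A: "A \<subseteq> {1..m}" and g: "g \<in> borel_measurable (knot_space m)"
    and f: "f \<in> borel_measurable (knot_space m)" and h: "h \<in> borel_measurable (knot_space m)"
    and Kf: "(\<lambda>x. \<integral>\<^sup>+y. f y \<partial>block_update m g A x) \<in> borel_measurable (knot_space m)"
    and finite: "\<And>v. (\<integral>\<^sup>+u. ennreal (g (replace_block m A u v)) \<partial>block_space A) \<notin> {0, \<infinity>}"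
  shows "(\<integral>\<^sup>+x. ennreal (g x) * (h x * (\<integral>\<^sup>+y. f y \<partial>block_update m g A x)) \<partial>knot_space m)
    = (\<integral>\<^sup>+v. (\<integral>\<^sup>+u. ennreal (g (replace_block m A u v)) \<partial>block_space A)
        * ((\<integral>\<^sup>+y. h y \<partial>block_update m g A v) * (\<integral>\<^sup>+y. f y \<partial>block_update m g A v)) \<partial>block_space ({1..m} - A))"
proof -
  let ?B = "{1..m} - A"
  define W where "W v = (\<integral>\<^sup>+u. ennreal (g (replace_block m A u v)) \<partial>block_space A)" for v
  define F where "F v = (\<integral>\<^sup>+y. f y \<partial>block_update m g A v)" for v
  interpret L: product_sigma_finite "\<lambda>_::nat. lborel :: real measure"
    by (simp add: product_sigma_finite_def lborel.sigma_finite_measure_axioms)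
  have finite_blocks: "finite A" "finite ?B" and union: "?B \<union> A = {1..m}" "?B \<inter> A = {}"
    using A finite_subset by auto
  have [measurable]: "g \<in> borel_measurable (knot_space m)" "h \<in> borel_measurable (knot_space m)"
    "F \<in> borel_measurable (knot_space m)" using g h Kf unfolding F_def[abs_def] .
  have "(\<lambda>x. ennreal (g x) * (h x * F x)) \<in> borel_measurable (knot_space m)" by measurable
  then have "(\<integral>\<^sup>+x. ennreal (g x) * (h x * F x) \<partial>knot_space m)
    = (\<integral>\<^sup>+v. (\<integral>\<^sup>+u. ennreal (g (merge ?B A (v, u))) * (h (merge ?B A (v, u)) * F (merge ?B A (v, u)))
        \<partial>block_space A) \<partial>block_space ?B)"
    using L.product_nn_integral_fold[OF union(2) finite_blocks(2,1)]
    unfolding union knot_space_def by blast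
  also have "\<dots> = (\<integral>\<^sup>+v. W v * ((\<integral>\<^sup>+y. h y \<partial>block_update m g A v) * F v) \<partial>block_space ?B)"
  proof (rule nn_integral_cong)
    fix v
    note [measurable] = replace_block_measurable[OF A, of v]
    have F_replace: "F (replace_block m A u v) = F v" for u
      unfolding F_def block_update_replace_block ..
    have "(\<integral>\<^sup>+u. ennreal (g (merge ?B A (v, u))) * (h (merge ?B A (v, u)) * F (merge ?B A (v, u)))
      \<partial>block_space A)
      = (\<integral>\<^sup>+u. ennreal (g (replace_block m A u v)) * h (replace_block m A u v) * F v \<partial>block_space A)"
      unfolding merge_commute[OF union(2)] F_replace by (simp add: mult_ac)
    also have "\<dots> = (\<integral>\<^sup>+u. ennreal (g (replace_block m A u v)) * h (replace_block m A u v) \<partial>block_space A) * F v"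
      by (rule nn_integral_multc) measurable
    also have "(\<integral>\<^sup>+u. ennreal (g (replace_block m A u v)) * h (replace_block m A u v) \<partial>block_space A)
      = W v * (\<integral>\<^sup>+y. h y \<partial>block_update m g A v)"
      using finite[of v] unfolding nn_integral_block_update[OF A g h] W_def[symmetric]
      by (simp add: ennreal_times_divide ennreal_mult_divide_eq mult.commute[of "W v"])
    finally show "(\<integral>\<^sup>+u. ennreal (g (merge ?B A (v, u))) * (h (merge ?B A (v, u)) * F (merge ?B A (v, u)))
      \<partial>block_space A)
      = W v * ((\<integral>\<^sup>+y. h y \<partial>block_update m g A v) * F v)" by (simp add: mult_ac)
  qed
  finally show ?thesis unfolding W_def F_def .
qed

subsection \<open>Gaussian autoregressive bridges\<close>

lemma space_knot_space: "space (knot_space m) = (\<Pi>\<^sub>E i\<in>{1..m}. UNIV)"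
  by (simp add: knot_space_def space_PiM)

lemma knot_component_measurable: "i \<in> {1..m} \<Longrightarrow> (\<lambda>x. x i) \<in> borel_measurable (knot_space m)"
  using measurable_component_singleton[of i "{1..m}" "\<lambda>_. lborel :: real measure"]
  by (simp add: knot_space_def)

text \<open>Both processes have transition densities of the form \<open>N(\<alpha> a, \<tau>\<^sup>2)\<close> over one time step, with
  \<open>\<alpha> = 1\<close> for Brownian motion and \<open>\<alpha> = exp (- \<theta> \<delta>)\<close> for the Ornstein--Uhlenbeck process.\<close>

locale autoregressive_bridge =
  fixes \<alpha> \<tau> x0 xT :: real and m :: nat
  assumes \<alpha>: "\<bar>\<alpha>\<bar> \<le> 1" and \<tau>: "0 < \<tau>" and m: "1 \<le> m"
begin

definition cond_sd :: real where
  "cond_sd = \<tau> / sqrt (1 + \<alpha>\<^sup>2)"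

definition bridge_path :: "(nat \<Rightarrow> real) \<Rightarrow> nat \<Rightarrow> real" where
  "bridge_path x i = (if i = 0 then x0 else if i \<le> m then x i else xT)"

definition dens :: "(nat \<Rightarrow> real) \<Rightarrow> real" where
  "dens x = (\<Prod>i\<in>{0..m}. normal_density (\<alpha> * bridge_path x i) \<tau> (bridge_path x (Suc i)))"

definition law :: "(nat \<Rightarrow> real) measure" where
  "law = normalised (knot_space m) dens"

definition cond_mean :: "(nat \<Rightarrow> real) \<Rightarrow> nat \<Rightarrow> real" where
  "cond_mean x i = neighbour_weight \<alpha> * (bridge_path x (i - 1) + bridge_path x (Suc i))"

definition state_diff :: "(nat \<Rightarrow> real) \<Rightarrow> (nat \<Rightarrow> real) \<Rightarrow> nat \<Rightarrow> real" where
  "state_diff x y i = bridge_path x i - bridge_path y i"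

definition block_dens :: "nat set \<Rightarrow> (nat \<Rightarrow> real) \<Rightarrow> (nat \<Rightarrow> real) \<Rightarrow> real" where
  "block_dens A x y = (\<Prod>i\<in>A. normal_density (cond_mean x i) cond_sd (y i))"

definition block_weight :: "nat set \<Rightarrow> (nat \<Rightarrow> real) \<Rightarrow> real" where
  "block_weight A x = (1 / sqrt (2 * pi * \<tau>\<^sup>2)) ^ Suc m * sqrt (2 * pi * cond_sd\<^sup>2) ^ card A
     * exp (- action \<alpha> m (gs_update \<alpha> A (bridge_path x)) / (2 * \<tau>\<^sup>2))"

definition noise :: "nat set \<Rightarrow> (nat \<Rightarrow> real) measure" where
  "noise A = Pi\<^sub>M A (\<lambda>_. normal_law 0 cond_sd)"

definition block_map :: "nat set \<Rightarrow> (nat \<Rightarrow> real) \<Rightarrow> (nat \<Rightarrow> real) \<Rightarrow> nat \<Rightarrow> real" where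
  "block_map A x z = (\<lambda>i\<in>{1..m}. if i \<in> A then z i + cond_mean x i else x i)"

abbreviation block_kernel :: "nat set \<Rightarrow> (nat \<Rightarrow> real) \<Rightarrow> (nat \<Rightarrow> real) measure" where
  "block_kernel \<equiv> block_update m dens"

lemma cond_sd_pos: "0 < cond_sd"
  using \<tau> one_plus_square_pos[of \<alpha>] by (simp add: cond_sd_def)

lemma bridge_path_inside: "i \<in> {1..m} \<Longrightarrow> bridge_path x i = x i"
  by (simp add: bridge_path_def)

lemma supported_state_diff: "supported m (state_diff x y)"
  by (auto simp: supported_def state_diff_def bridge_path_def)

lemma dens_eq_exp_action:
  "dens x = (1 / sqrt (2 * pi * \<tau>\<^sup>2)) ^ Suc m * exp (- action \<alpha> m (bridge_path x) / (2 * \<tau>\<^sup>2))"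
proof -
  have "dens x = (\<Prod>i\<in>{0..m}. 1 / sqrt (2 * pi * \<tau>\<^sup>2) *
      exp (- (bridge_path x (Suc i) - \<alpha> * bridge_path x i)\<^sup>2 / (2 * \<tau>\<^sup>2)))"
    by (simp add: dens_def normal_density_def)
  also have "\<dots> = (1 / sqrt (2 * pi * \<tau>\<^sup>2)) ^ Suc m *
      exp (\<Sum>i=0..m. - (bridge_path x (Suc i) - \<alpha> * bridge_path x i)\<^sup>2 / (2 * \<tau>\<^sup>2))"
    unfolding prod.distrib exp_sum[OF finite_atLeastAtMost] by simp
  finally show ?thesis by (simp add: action_def sum_divide_distrib[symmetric] sum_negf)
qed

lemma dens_pos: "0 < dens x"
  unfolding dens_eq_exp_action using \<tau> by simp

lemma dens_replace_block:
  assumes block: "independent_block m A"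
  shows "dens (replace_block m A y x) = block_weight A x * block_dens A x y"
proof -
  define S where "S = (\<Sum>i\<in>A. (y i - cond_mean x i)\<^sup>2)"
  let ?xy = "replace_block m A y x"
  have on_block: "bridge_path ?xy i = y i" if "i \<in> A" for i
    using that independent_block_subset[OF block] by (auto simp: bridge_path_def merge_def)
  have "action \<alpha> m (bridge_path ?xy) = action \<alpha> m (gs_update \<alpha> A (bridge_path x)) + (1 + \<alpha>\<^sup>2) * S"
  proof -
    have "(\<Sum>i\<in>A. (bridge_path ?xy i - gs_update \<alpha> A (bridge_path x) i)\<^sup>2) = S"
      unfolding S_def
      by (intro sum.cong refl) (simp add: on_block[simplified] gs_update_def cond_mean_def)
    moreover have "bridge_path ?xy i = bridge_path x i" if "i \<notin> A" for i
      using that by (auto simp: bridge_path_def merge_def)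
    ultimately show ?thesis
      using action_eq_gs_update[OF block, of "bridge_path ?xy" "bridge_path x" \<alpha>] by simp
  qed
  moreover have "(1 + \<alpha>\<^sup>2) * S / (2 * \<tau>\<^sup>2) = S / (2 * cond_sd\<^sup>2)"
    using \<tau> one_plus_square_pos[of \<alpha>] by (simp add: cond_sd_def power_divide field_simps)
  ultimately have split: "- action \<alpha> m (bridge_path ?xy) / (2 * \<tau>\<^sup>2)
      = - action \<alpha> m (gs_update \<alpha> A (bridge_path x)) / (2 * \<tau>\<^sup>2) + - S / (2 * cond_sd\<^sup>2)"
    by (simp add: add_divide_distrib diff_divide_distrib)
  have "block_dens A x y = (1 / sqrt (2 * pi * cond_sd\<^sup>2)) ^ card A * exp (- S / (2 * cond_sd\<^sup>2))"
    unfolding block_dens_def normal_density_def prod.distrib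
      exp_sum[OF independent_block_finite[OF block], symmetric]
    by (simp add: S_def sum_negf sum_divide_distrib)
  then show ?thesis
    unfolding dens_eq_exp_action split exp_add
    using cond_sd_pos by (simp add: block_weight_def power_divide)
qed

lemma block_weight_pos: "0 < block_weight A x"
  using \<tau> cond_sd_pos by (simp add: block_weight_def)

lemma block_dens_nonneg: "0 \<le> block_dens A x y"
  by (simp add: block_dens_def prod_nonneg)

lemma block_dens_measurable: "block_dens A x \<in> borel_measurable (block_space A)"
proof -
  have [measurable]: "(\<lambda>y. y i) \<in> borel_measurable (block_space A)" if "i \<in> A" for i
    using measurable_component_singleton[OF that, of "\<lambda>_. lborel :: real measure"] by simp
  show ?thesis unfolding block_dens_def[abs_def] by measurable
qed

lemma density_block_dens:
  assumes "finite A"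
  shows "density (block_space A) (block_dens A x) = Pi\<^sub>M A (\<lambda>i. normal_law (cond_mean x i) cond_sd)"
  unfolding normal_law_def block_dens_def using assms
  by (intro PiM_density_prod[where f="\<lambda>i. normal_density (cond_mean x i) cond_sd"])
    (auto intro: lborel.sigma_finite_measure_axioms)

lemma prob_space_density_block_dens:
  "finite A \<Longrightarrow> prob_space (density (block_space A) (block_dens A x))"
  unfolding density_block_dens by (intro prob_space_PiM prob_space_normal_law cond_sd_pos)

lemma nn_integral_block_dens:
  assumes "finite A"
  shows "(\<integral>\<^sup>+y. ennreal (block_dens A x y) \<partial>block_space A) = 1"
proof -
  have "(\<integral>\<^sup>+y. 1 \<partial>density (block_space A) (block_dens A x)) = 1"
    using prob_space.emeasure_space_1[OF prob_space_density_block_dens[OF assms]] by simp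
  then show ?thesis using block_dens_measurable[of A x] by (subst (asm) nn_integral_density) auto
qed

lemma block_dens_integrable:
  assumes "finite A"
  shows "integrable (block_space A) (block_dens A x)" "(\<integral>y. block_dens A x y \<partial>block_space A) = 1"
  using nn_integral_block_dens[OF assms, of x] block_dens_measurable[of A x] block_dens_nonneg[of A x]
  by (auto intro: integrableI_nonneg simp: integral_eq_nn_integral)

lemma block_kernel_eq_density:
  assumes block: "independent_block m A"
  shows "block_kernel A x
    = distr (density (block_space A) (block_dens A x)) (knot_space m) (\<lambda>y. replace_block m A y x)"
  unfolding block_update_def dens_replace_block[OF block]
  using normalised_scaled_density[OF block_weight_pos block_dens_measurable block_dens_nonneg
      nn_integral_block_dens[OF independent_block_finite[OF block]]] by simp

lemma block_kernel_eq_noise: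
  assumes block: "independent_block m A" and x: "x \<in> space (knot_space m)"
  shows "block_kernel A x = distr (noise A) (knot_space m) (block_map A x)"
proof -
  have shift: "(\<lambda>z. \<lambda>i\<in>A. z i + cond_mean x i) \<in> Pi\<^sub>M A (\<lambda>_. normal_law 0 cond_sd) \<rightarrow>\<^sub>M block_space A"
    by (rule measurable_restrict)
      (auto intro!: borel_measurable_add
        measurable_component_singleton[of _ A "\<lambda>_. normal_law 0 cond_sd", simplified])
  have "block_kernel A x = distr (distr (noise A) (block_space A) (\<lambda>z. \<lambda>i\<in>A. z i + cond_mean x i))
      (knot_space m) (\<lambda>y. replace_block m A y x)"
    unfolding block_kernel_eq_density[OF block] density_block_dens[OF independent_block_finite[OF block]]
      noise_def
    by (simp only: PiM_normal_law_translate[OF independent_block_finite[OF block] cond_sd_pos,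
          of "cond_mean x"])
  also have "\<dots> = distr (noise A) (knot_space m) ((\<lambda>y. replace_block m A y x) \<circ> (\<lambda>z. \<lambda>i\<in>A. z i + cond_mean x i))"
    unfolding noise_def
    using replace_block_measurable[OF independent_block_subset[OF block]] shift
    by (rule distr_distr)
  also have "(\<lambda>y. replace_block m A y x) \<circ> (\<lambda>z. \<lambda>i\<in>A. z i + cond_mean x i) = block_map A x"
    using independent_block_subset[OF block]
    by (auto simp: block_map_def merge_def fun_eq_iff restrict_def)
  finally show ?thesis .
qed

lemma bridge_path_measurable: "(\<lambda>x. bridge_path x i) \<in> borel_measurable (knot_space m)"
  using knot_component_measurable[of i m] by (cases "i = 0 \<or> m < i") (auto simp: bridge_path_def)

lemma dens_measurable: "dens \<in> borel_measurable (knot_space m)"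
proof -
  note [measurable] = bridge_path_measurable
  show ?thesis unfolding dens_def[abs_def] normal_density_def by measurable
qed

lemma cond_mean_measurable: "(\<lambda>x. cond_mean x i) \<in> borel_measurable (knot_space m)"
  unfolding cond_mean_def
  by (intro borel_measurable_times borel_measurable_add bridge_path_measurable) auto

lemma dens_gaussian_bound:
  obtains D b where "0 < D" "0 < b" "\<And>x. dens x \<le> D * exp (- b * (\<Sum>i=1..m. (x i)\<^sup>2))"
proof
  define Z where "Z = (1 / sqrt (2 * pi * \<tau>\<^sup>2)) ^ Suc m"
  define b where "b = 1 / (4 * (real m)\<^sup>2 * \<tau>\<^sup>2)"
  define D where "D = Z * exp (b * (2 * real m * x0\<^sup>2))"
  have Z_pos: "0 < Z" using \<tau> by (simp add: Z_def)
  then show "0 < D" by (simp add: D_def)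
  show b_pos: "0 < b" using \<tau> m by (simp add: b_def)
  fix x
  define a where "a = action \<alpha> m (bridge_path x)"
  have "(x i)\<^sup>2 \<le> 2 * x0\<^sup>2 + 2 * (real m * a)" if i: "i \<in> {1..m}" for i
  proof -
    have "\<bar>x i\<bar> \<le> \<bar>x0\<bar> + sqrt (real m * a)"
      using abs_le_sqrt_action[OF \<alpha>, of i m "bridge_path x"] i bridge_path_inside[OF i, of x]
      by (simp add: a_def bridge_path_def)
    then have "\<bar>x i\<bar>\<^sup>2 \<le> (\<bar>x0\<bar> + sqrt (real m * a))\<^sup>2" by (intro power_mono) auto
    also have "\<dots> \<le> 2 * \<bar>x0\<bar>\<^sup>2 + 2 * (sqrt (real m * a))\<^sup>2"
      using sum_squares_bound[of "\<bar>x0\<bar>" "sqrt (real m * a)"] unfolding power2_sum by linarith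
    finally show ?thesis by (simp add: a_def action_nonneg)
  qed
  then have "(\<Sum>i=1..m. (x i)\<^sup>2) \<le> 2 * real m * x0\<^sup>2 + 2 * (real m)\<^sup>2 * a"
    using sum_mono[of "{1..m}" "\<lambda>i. (x i)\<^sup>2" "\<lambda>_. 2 * x0\<^sup>2 + 2 * (real m * a)"]
    by (simp add: power2_eq_square algebra_simps)
  then have "b * (\<Sum>i=1..m. (x i)\<^sup>2) \<le> b * (2 * real m * x0\<^sup>2 + 2 * (real m)\<^sup>2 * a)"
    using b_pos by (intro mult_left_mono) auto
  also have "\<dots> = b * (2 * real m * x0\<^sup>2) + a / (2 * \<tau>\<^sup>2)"
    using m \<tau> by (simp add: b_def distrib_left)
  finally have "- a / (2 * \<tau>\<^sup>2) \<le> b * (2 * real m * x0\<^sup>2) + - b * (\<Sum>i=1..m. (x i)\<^sup>2)" by simp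
  then have "exp (- a / (2 * \<tau>\<^sup>2)) \<le> exp (b * (2 * real m * x0\<^sup>2)) * exp (- b * (\<Sum>i=1..m. (x i)\<^sup>2))"
    unfolding exp_add[symmetric] by (rule exp_le_cancel_iff[THEN iffD2])
  then have "Z * exp (- a / (2 * \<tau>\<^sup>2)) \<le> Z * (exp (b * (2 * real m * x0\<^sup>2)) * exp (- b * (\<Sum>i=1..m. (x i)\<^sup>2)))"
    using Z_pos by (intro mult_left_mono) auto
  then show "dens x \<le> D * exp (- b * (\<Sum>i=1..m. (x i)\<^sup>2))"
    by (simp add: dens_eq_exp_action D_def Z_def a_def mult.assoc)
qed

end

lemma nn_integral_gaussian_finite:
  assumes b: "0 < b"
  shows "(\<integral>\<^sup>+x. ennreal (exp (- b * (\<Sum>i=1..m. (x i)\<^sup>2))) \<partial>knot_space m) < \<infinity>"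
proof -
  interpret product_sigma_finite "\<lambda>_::nat. lborel :: real measure"
    by (simp add: product_sigma_finite_def lborel.sigma_finite_measure_axioms)
  define \<sigma> where "\<sigma> = 1 / sqrt (2 * b)"
  have \<sigma>: "0 < \<sigma>" "2 * \<sigma>\<^sup>2 = 1 / b" using b by (auto simp: \<sigma>_def power_divide)
  have "exp (- b * t\<^sup>2) = sqrt (2 * pi * \<sigma>\<^sup>2) * normal_density 0 \<sigma> t" for t
    using \<sigma> by (simp add: normal_density_def)
  then have "(\<lambda>t. exp (- b * t\<^sup>2)) = (\<lambda>t. sqrt (2 * pi * \<sigma>\<^sup>2) * normal_density 0 \<sigma> t)" by (rule ext)
  then have "integrable lborel (\<lambda>t. exp (- b * t\<^sup>2))"
    using integrable_normal_density[OF \<sigma>(1)] by simp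
  then have one_dim: "(\<integral>\<^sup>+t. ennreal (exp (- b * t\<^sup>2)) \<partial>lborel) < \<infinity>"
    by (simp add: nn_integral_eq_integral)
  have "(\<integral>\<^sup>+x. ennreal (exp (- b * (\<Sum>i=1..m. (x i)\<^sup>2))) \<partial>knot_space m)
    = (\<integral>\<^sup>+x. (\<Prod>i\<in>{1..m}. ennreal (exp (- b * (x i)\<^sup>2))) \<partial>knot_space m)"
    by (intro nn_integral_cong) (simp add: sum_distrib_left exp_sum[symmetric] sum_negf[symmetric] prod_ennreal)
  also have "\<dots> = (\<Prod>i\<in>{1..m}. \<integral>\<^sup>+t. ennreal (exp (- b * t\<^sup>2)) \<partial>lborel)"
    unfolding knot_space_def by (rule product_nn_integral_prod) auto
  also have "\<dots> < \<infinity>" using one_dim by (simp add: power_less_top_ennreal)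
  finally show ?thesis .
qed

context autoregressive_bridge
begin

lemma nn_integral_dens_finite: "(\<integral>\<^sup>+x. ennreal (dens x) \<partial>knot_space m) < \<infinity>"
proof -
  obtain D b where dens_le: "0 < D" "0 < b" "\<And>x. dens x \<le> D * exp (- b * (\<Sum>i=1..m. (x i)\<^sup>2))"
    using dens_gaussian_bound by blast
  have [measurable]: "(\<lambda>x. exp (- b * (\<Sum>i=1..m. (x i)\<^sup>2))) \<in> borel_measurable (knot_space m)"
    using knot_component_measurable by measurable
  have "(\<integral>\<^sup>+x. ennreal (dens x) \<partial>knot_space m)
      \<le> (\<integral>\<^sup>+x. ennreal D * ennreal (exp (- b * (\<Sum>i=1..m. (x i)\<^sup>2))) \<partial>knot_space m)"
    using dens_le by (intro nn_integral_mono) (simp add: ennreal_mult[symmetric] ennreal_leI)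
  also have "\<dots> = ennreal D * (\<integral>\<^sup>+x. ennreal (exp (- b * (\<Sum>i=1..m. (x i)\<^sup>2))) \<partial>knot_space m)"
    by (rule nn_integral_cmult) measurable
  also have "\<dots> < \<infinity>"
    using nn_integral_gaussian_finite[OF dens_le(2)] by (simp add: ennreal_mult_less_top)
  finally show ?thesis .
qed

lemma nn_integral_dens_nonzero: "(\<integral>\<^sup>+x. ennreal (dens x) \<partial>knot_space m) \<noteq> 0"
proof
  interpret product_sigma_finite "\<lambda>_::nat. lborel :: real measure"
    by (simp add: product_sigma_finite_def lborel.sigma_finite_measure_axioms)
  assume "(\<integral>\<^sup>+x. ennreal (dens x) \<partial>knot_space m) = 0"
  then have "AE x in knot_space m. ennreal (dens x) = 0"
    using dens_measurable by (subst (asm) nn_integral_0_iff_AE) auto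
  then have "AE x in knot_space m. False" using dens_pos by (auto simp: ennreal_eq_0_iff not_le)
  then have "emeasure (knot_space m) (space (knot_space m)) = 0"
    using AE_iff_null_sets[OF sets.top, of "knot_space m"] by (auto simp: null_sets_def)
  moreover have "emeasure (knot_space m) (space (knot_space m))
      = (\<Prod>i\<in>{1..m}. emeasure lborel (UNIV :: real set))"
    unfolding space_knot_space unfolding knot_space_def by (rule emeasure_PiM) auto
  ultimately show False by simp
qed

lemma sets_law[simp, measurable_cong]: "sets law = sets (knot_space m)"
  by (simp add: law_def normalised_def)

lemma space_law[simp]: "space law = space (knot_space m)"
  by (simp add: law_def normalised_def)

lemma measurable_law: "measurable law N = measurable (knot_space m) N"
  by (rule measurable_cong_sets) auto

lemma prob_algebra_law: "prob_algebra law = prob_algebra (knot_space m)"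
  unfolding prob_algebra_def by (simp add: subprob_algebra_cong[OF sets_law])

lemma prob_space_law: "prob_space law"
  unfolding law_def
  using dens_measurable nn_integral_dens_nonzero nn_integral_dens_finite
  by (rule prob_space_normalised)

lemma law_second_moment: "integrable law (\<lambda>x. \<Sum>i=1..m. (x i)\<^sup>2)"
proof (rule integrableI_nonneg)
  define S where "S x = (\<Sum>i=1..m. (x i)\<^sup>2)" for x :: "nat \<Rightarrow> real"
  have S_nonneg: "0 \<le> S x" for x by (simp add: S_def sum_nonneg)
  have S_measurable[measurable]: "S \<in> borel_measurable (knot_space m)"
    unfolding S_def using knot_component_measurable by measurable
  then show "(\<lambda>x. \<Sum>i=1..m. (x i)\<^sup>2) \<in> borel_measurable law"
    by (simp add: S_def[abs_def] cong: measurable_cong_sets)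
  show "AE x in law. 0 \<le> (\<Sum>i=1..m. (x i)\<^sup>2)" by (simp add: sum_nonneg)
  obtain D b where dens_le: "0 < D" "0 < b" "\<And>x. dens x \<le> D * exp (- b * S x)"
    using dens_gaussian_bound unfolding S_def by blast
  have "dens x * S x \<le> (2 * D / b) * exp (- (b / 2) * S x)" for x
  proof -
    have "b / 2 * S x \<le> exp (b / 2 * S x)" using exp_ge_add_one_self[of "b / 2 * S x"] by linarith
    then have "S x \<le> (2 / b) * exp (b / 2 * S x)" using dens_le by (simp add: field_simps)
    then have "dens x * S x \<le> (D * exp (- b * S x)) * ((2 / b) * exp (b / 2 * S x))"
      using dens_le S_nonneg dens_pos[of x] by (intro mult_mono) auto
    also have "\<dots> = (2 * D / b) * (exp (- b * S x) * exp (b / 2 * S x))" by simp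
    also have "exp (- b * S x) * exp (b / 2 * S x) = exp (- (b / 2) * S x)"
      unfolding exp_add[symmetric] by simp
    finally show ?thesis .
  qed
  then have "(\<integral>\<^sup>+x. ennreal (dens x) * ennreal (S x) \<partial>knot_space m)
      \<le> (\<integral>\<^sup>+x. ennreal (2 * D / b) * ennreal (exp (- (b / 2) * S x)) \<partial>knot_space m)"
    using S_nonneg dens_pos dens_le
    by (intro nn_integral_mono) (simp add: ennreal_mult[symmetric] less_imp_le ennreal_leI)
  also have "\<dots> = ennreal (2 * D / b) * (\<integral>\<^sup>+x. ennreal (exp (- (b / 2) * S x)) \<partial>knot_space m)"
    by (rule nn_integral_cmult) measurable
  also have "\<dots> < \<infinity>"
    using nn_integral_gaussian_finite[of "b / 2"] dens_le(2)
    unfolding S_def by (simp add: ennreal_mult_less_top)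
  finally have "(\<integral>\<^sup>+x. ennreal (S x) \<partial>law) < \<infinity>"
    unfolding law_def using dens_measurable nn_integral_dens_nonzero
    by (subst nn_integral_normalised) (auto simp: ennreal_divide_eq_top_iff top.not_eq_extremum[symmetric])
  then show "(\<integral>\<^sup>+x. ennreal (\<Sum>i=1..m. (x i)\<^sup>2) \<partial>law) < \<infinity>" by (simp add: S_def)
qed

lemma prob_space_noise: "prob_space (noise A)"
  unfolding noise_def by (intro prob_space_PiM prob_space_normal_law cond_sd_pos)

lemma block_map_measurable:
  "(\<lambda>(x, z). block_map A x z) \<in> knot_space m \<Otimes>\<^sub>M noise A \<rightarrow>\<^sub>M knot_space m"
proof -
  have "(\<lambda>p. if i \<in> A then snd p i + cond_mean (fst p) i else fst p i)
      \<in> borel_measurable (knot_space m \<Otimes>\<^sub>M noise A)"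
    if i: "i \<in> {1..m}" for i
  proof (cases "i \<in> A")
    case True
    then have "(\<lambda>z. z i) \<in> borel_measurable (noise A)"
      using measurable_component_singleton[of i A "\<lambda>_. normal_law 0 cond_sd"]
      by (simp add: noise_def)
    note [measurable] = measurable_compose[OF measurable_snd this]
      measurable_compose[OF measurable_fst cond_mean_measurable]
    show ?thesis using True by simp
  next
    case False
    then show ?thesis
      using measurable_compose[OF measurable_fst knot_component_measurable[OF i]] by simp
  qed
  then show ?thesis unfolding block_map_def[abs_def] knot_space_def[of m] split_beta
    by (intro measurable_restrict) (simp add: knot_space_def)
qed

lemma block_kernel_measurable:
  assumes block: "independent_block m A"
  shows "block_kernel A \<in> law \<rightarrow>\<^sub>M prob_algebra law"
proof -
  have "(\<lambda>x. distr (noise A) (knot_space m) (block_map A x)) \<in> knot_space m \<rightarrow>\<^sub>M prob_algebra (knot_space m)"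
    using prob_space_noise
    by (intro measurable_distr_prob_space2[OF _ block_map_measurable] measurable_const)
      (simp add: space_prob_algebra)
  then show ?thesis unfolding prob_algebra_law measurable_law
    by (subst measurable_cong[OF block_kernel_eq_noise[OF block]]) auto
qed

lemma block_kernel_reversible:
  assumes block: "independent_block m A"
  shows "reversible_kernel law (block_kernel A)"
  unfolding reversible_kernel_def
proof (intro conjI ballI block_kernel_measurable block)
  fix f h :: "(nat \<Rightarrow> real) \<Rightarrow> ennreal"
  assume "f \<in> borel_measurable law" "h \<in> borel_measurable law"
  then have fh: "f \<in> borel_measurable (knot_space m)" "h \<in> borel_measurable (knot_space m)"
    by (simp_all add: measurable_law)
  have kernel: "(\<lambda>x. \<integral>\<^sup>+y. g y \<partial>block_kernel A x) \<in> borel_measurable (knot_space m)"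
    if "g \<in> borel_measurable (knot_space m)" for g
    using measurable_compose[OF measurable_prob_algebraD[OF block_kernel_measurable[OF block]]
      nn_integral_measurable_subprob_algebra, of g] that
    by (simp add: measurable_law)
  have "(\<integral>\<^sup>+u. ennreal (dens (replace_block m A u v)) \<partial>block_space A) = ennreal (block_weight A v)" for v
    unfolding dens_replace_block[OF block]
    using block_weight_pos[of A v] block_dens_nonneg[of A v] block_dens_measurable[of A v]
      nn_integral_block_dens[OF independent_block_finite[OF block], of v]
    by (simp add: ennreal_mult nn_integral_cmult)
  then have finite: "(\<integral>\<^sup>+u. ennreal (dens (replace_block m A u v)) \<partial>block_space A) \<notin> {0, \<infinity>}" for v
    using block_weight_pos[of A v] by (simp add: ennreal_eq_0_iff)
  note conditional =
    nn_integral_mult_block_update[OF independent_block_subset[OF block] dens_measurable _ _ kernel finite]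
  have "(\<integral>\<^sup>+x. ennreal (dens x) * (h x * (\<integral>\<^sup>+y. f y \<partial>block_kernel A x)) \<partial>knot_space m)
    = (\<integral>\<^sup>+x. ennreal (dens x) * (f x * (\<integral>\<^sup>+y. h y \<partial>block_kernel A x)) \<partial>knot_space m)"
    unfolding conditional[OF fh fh(1)] conditional[OF fh(2,1) fh(2)] by (simp add: mult_ac)
  then show "(\<integral>\<^sup>+x. h x * (\<integral>\<^sup>+y. f y \<partial>block_kernel A x) \<partial>law)
      = (\<integral>\<^sup>+x. f x * (\<integral>\<^sup>+y. h y \<partial>block_kernel A x) \<partial>law)"
    unfolding law_def
    using fh kernel[OF fh(1)] kernel[OF fh(2)] dens_measurable by (simp add: nn_integral_normalised)
qed

subsection \<open>Sweeps are smoothing\<close>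

definition lipschitz_along :: "nat set \<Rightarrow> real \<Rightarrow> ((nat \<Rightarrow> real) \<Rightarrow> real) \<Rightarrow> bool" where
  "lipschitz_along S L f \<longleftrightarrow> (\<forall>x\<in>space (knot_space m). \<forall>y\<in>space (knot_space m).
     (\<forall>i\<in>{1..m} - S. x i = y i) \<longrightarrow> \<bar>f x - f y\<bar> \<le> L * L2_set (state_diff x y) {1..m})"

lemma L2_set_cond_mean_diff_le:
  assumes A: "A \<subseteq> {1..m}"
  shows "L2_set (\<lambda>i. cond_mean x i - cond_mean y i) A \<le> L2_set (state_diff x y) {1..m}"
proof -
  define d where "d = state_diff x y"
  have "(cond_mean x i - cond_mean y i)\<^sup>2 \<le> (1 / 2) * ((d (i - 1))\<^sup>2 + (d (Suc i))\<^sup>2)" for i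
  proof -
    have "cond_mean x i - cond_mean y i = neighbour_weight \<alpha> * (d (i - 1) + d (Suc i))"
      by (simp add: cond_mean_def d_def state_diff_def algebra_simps)
    moreover have "(neighbour_weight \<alpha>)\<^sup>2 \<le> (1 / 2)\<^sup>2"
      using abs_neighbour_weight_le[of \<alpha>] by (metis abs_ge_zero power2_abs power_mono)
    ultimately have "(cond_mean x i - cond_mean y i)\<^sup>2 \<le> (1 / 2)\<^sup>2 * (d (i - 1) + d (Suc i))\<^sup>2"
      unfolding power_mult_distrib by (simp add: mult_right_mono power_mult_distrib)
    then show ?thesis
      using sum_squares_bound[of "d (i - 1)" "d (Suc i)"] by (simp add: power2_sum power_divide)
  qed
  then have "(\<Sum>i\<in>A. (cond_mean x i - cond_mean y i)\<^sup>2) \<le> (\<Sum>i=1..m. (1 / 2) * ((d (i - 1))\<^sup>2 + (d (Suc i))\<^sup>2))"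
    using A by (intro order_trans[OF sum_mono sum_mono2]) auto
  also have "\<dots> = (1 / 2) * ((\<Sum>i=1..m. (d (i - 1))\<^sup>2) + (\<Sum>i=1..m. (d (Suc i))\<^sup>2))"
    unfolding sum.distrib[symmetric] sum_distrib_left ..
  also have "\<dots> \<le> (\<Sum>i=1..m. (d i)\<^sup>2)"
    using sum_squares_shift_le[OF supported_state_diff, of x y] by (simp add: d_def)
  finally show ?thesis unfolding L2_set_def d_def by (rule real_sqrt_le_mono)
qed

lemma kernel_op_block_kernel:
  assumes block: "independent_block m A" and f: "f \<in> borel_measurable (knot_space m)"
  shows "kernel_op (block_kernel A) f x
    = (\<integral>y. block_dens A x y * f (replace_block m A y x) \<partial>block_space A)"
proof -
  note merge = replace_block_measurable[OF independent_block_subset[OF block], of x]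
  have "kernel_op (block_kernel A) f x
    = (\<integral>y. f (replace_block m A y x) \<partial>density (block_space A) (block_dens A x))"
    unfolding kernel_op_def block_kernel_eq_density[OF block]
    using merge f by (intro integral_distr) simp_all
  also have "\<dots> = (\<integral>y. block_dens A x y * f (replace_block m A y x) \<partial>block_space A)"
    using measurable_compose[OF merge f] block_dens_measurable block_dens_nonneg
    by (subst integral_density) auto
  finally show ?thesis .
qed

lemma integrable_block_dens_mult:
  assumes A: "finite A" and u: "bounded_measurable (block_space A) u"
  shows "integrable (block_space A) (\<lambda>z. block_dens A x z * u z)"
proof -
  obtain B where u_le: "0 \<le> B" "\<And>z. z \<in> space (block_space A) \<Longrightarrow> \<bar>u z\<bar> \<le> B"
    using bounded_measurableE[OF u] by blast
  show ?thesis
  proof (rule Bochner_Integration.integrable_bound)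
    show "integrable (block_space A) (\<lambda>z. B * block_dens A x z)"
      using block_dens_integrable(1)[OF A] by simp
    show "(\<lambda>z. block_dens A x z * u z) \<in> borel_measurable (block_space A)"
      using block_dens_measurable bounded_measurable_measurable[OF u] by simp
    show "AE z in block_space A. norm (block_dens A x z * u z) \<le> norm (B * block_dens A x z)"
      using u_le block_dens_nonneg
      by (intro AE_I2) (simp add: abs_mult mult.commute mult_right_mono)
  qed
qed

lemma integral_block_dens_diff_le:
  assumes A: "A \<subseteq> {1..m}" and u: "u \<in> borel_measurable (block_space A)"
    and u_le: "\<And>z. z \<in> space (block_space A) \<Longrightarrow> \<bar>u z\<bar> \<le> B" "0 \<le> B"
  shows "\<bar>(\<integral>z. block_dens A x z * u z \<partial>block_space A) - (\<integral>z. block_dens A y z * u z \<partial>block_space A)\<bar>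
    \<le> B / cond_sd * L2_set (state_diff x y) {1..m}"
proof -
  have finite_A: "finite A" using A finite_subset by blast
  have "bounded_measurable (block_space A) u" using u u_le(1) by (auto simp: bounded_measurable_def)
  then have "(\<integral>z. block_dens A x z * u z \<partial>block_space A) - (\<integral>z. block_dens A y z * u z \<partial>block_space A)
      = (\<integral>z. (block_dens A x z - block_dens A y z) * u z \<partial>block_space A)"
    using integrable_block_dens_mult[OF finite_A] by (simp add: left_diff_distrib)
  then have "\<bar>(\<integral>z. block_dens A x z * u z \<partial>block_space A) - (\<integral>z. block_dens A y z * u z \<partial>block_space A)\<bar>
      \<le> (\<integral>z. \<bar>(block_dens A x z - block_dens A y z) * u z\<bar> \<partial>block_space A)"
    using integral_abs_bound by metis
  also have "\<dots> \<le> (\<integral>z. B * \<bar>block_dens A x z - block_dens A y z\<bar> \<partial>block_space A)"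
    using u_le block_dens_integrable(1)[OF finite_A]
    by (intro integral_mono') (auto simp: abs_mult mult.commute mult_right_mono)
  also have "\<dots> = B * (\<integral>z. \<bar>block_dens A x z - block_dens A y z\<bar> \<partial>block_space A)" by simp
  also have "\<dots> \<le> B * (L2_set (\<lambda>i. cond_mean x i - cond_mean y i) A / cond_sd)"
    unfolding block_dens_def
    using u_le(2) finite_A cond_sd_pos by (intro mult_left_mono L1_dist_normal_product_le)
  also have "\<dots> \<le> B * (L2_set (state_diff x y) {1..m} / cond_sd)"
    using u_le(2) L2_set_cond_mean_diff_le[OF A] cond_sd_pos
    by (intro mult_left_mono divide_right_mono) auto
  finally show ?thesis by simp
qed

lemma L2_set_state_diff_replace_block_le:
  "L2_set (state_diff (replace_block m A z x) (replace_block m A z y)) {1..m} \<le> L2_set (state_diff x y) {1..m}"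
  unfolding L2_set_def
  by (intro real_sqrt_le_mono sum_mono) (auto simp: state_diff_def bridge_path_def merge_def)

text \<open>Moving the coordinates in \<open>A\<close> of the starting state does not change the law of the update, and moving
  the others shifts the means of the new block, which costs a total variation distance linear in the
  displacement.\<close>

lemma lipschitz_along_block_kernel:
  assumes block: "independent_block m A" and f: "f \<in> borel_measurable (knot_space m)"
    and f_le: "\<And>x. x \<in> space (knot_space m) \<Longrightarrow> \<bar>f x\<bar> \<le> B" "0 \<le> B"
    and lipschitz: "lipschitz_along S L f" "0 \<le> L"
  shows "lipschitz_along (S \<union> A) (L + B / cond_sd) (kernel_op (block_kernel A) f)"
  unfolding lipschitz_along_def
proof (intro ballI impI)
  fix x y :: "nat \<Rightarrow> real" assume agree: "\<forall>i\<in>{1..m} - (S \<union> A). x i = y i"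
  define d where "d = L2_set (state_diff x y) {1..m}"
  define u where "u v z = f (replace_block m A z v)" for v z
  note merge = replace_block_measurable[OF independent_block_subset[OF block]]
  note block_dens = block_dens_integrable[OF independent_block_finite[OF block]]
  have u_measurable: "u v \<in> borel_measurable (block_space A)" for v
    unfolding u_def using measurable_compose[OF merge f] .
  have u_le: "\<bar>u v z\<bar> \<le> B" if "z \<in> space (block_space A)" for v z
    unfolding u_def using measurable_space[OF merge that] by (rule f_le)
  have int_mult: "integrable (block_space A) (\<lambda>z. block_dens A w z * u v z)" for v w
    using u_measurable u_le
    by (intro integrable_block_dens_mult independent_block_finite[OF block]) (auto simp: bounded_measurable_def)
  have "\<bar>u x z - u y z\<bar> \<le> L * d" if z: "z \<in> space (block_space A)" for z
  proof -
    let ?x = "replace_block m A z x" and ?y = "replace_block m A z y"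
    have "\<forall>i\<in>{1..m} - S. ?x i = ?y i" using agree by (auto simp: merge_def)
    then have "\<bar>u x z - u y z\<bar> \<le> L * L2_set (state_diff ?x ?y) {1..m}"
      using lipschitz(1) measurable_space[OF merge z] unfolding lipschitz_along_def u_def by blast
    also have "\<dots> \<le> L * d"
      unfolding d_def using L2_set_state_diff_replace_block_le lipschitz(2) by (rule mult_left_mono)
    finally show ?thesis .
  qed
  then have "(\<integral>z. \<bar>block_dens A y z * (u x z - u y z)\<bar> \<partial>block_space A)
      \<le> (\<integral>z. block_dens A y z * (L * d) \<partial>block_space A)"
    using block_dens(1) block_dens_nonneg lipschitz(2)
    by (intro integral_mono') (auto simp: abs_mult d_def L2_set_nonneg intro!: mult_left_mono)
  then have "\<bar>(\<integral>z. block_dens A y z * u x z \<partial>block_space A)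
      - (\<integral>z. block_dens A y z * u y z \<partial>block_space A)\<bar> \<le> L * d"
    using int_mult integral_abs_bound[of "block_space A" "\<lambda>z. block_dens A y z * (u x z - u y z)"] block_dens(2)
    by (simp add: right_diff_distrib)
  moreover have "\<bar>(\<integral>z. block_dens A x z * u x z \<partial>block_space A)
      - (\<integral>z. block_dens A y z * u x z \<partial>block_space A)\<bar> \<le> B / cond_sd * d"
    unfolding d_def
    using independent_block_subset[OF block] u_measurable u_le f_le(2)
    by (rule integral_block_dens_diff_le)
  moreover have kernel_op_eq: "kernel_op (block_kernel A) f v
      = (\<integral>z. block_dens A v z * u v z \<partial>block_space A)" for v
    unfolding u_def using block f by (rule kernel_op_block_kernel)
  ultimately show "\<bar>kernel_op (block_kernel A) f x - kernel_op (block_kernel A) f y\<bar>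
      \<le> (L + B / cond_sd) * L2_set (state_diff x y) {1..m}"
    unfolding d_def[symmetric] distrib_right kernel_op_eq by linarith
qed

lemma kernel_ops_bounded_measurable:
  assumes "\<forall>A\<in>set As. independent_block m A" "bounded_measurable law f"
  shows "bounded_measurable law (kernel_ops (map block_kernel As) f)"
proof -
  interpret law: prob_space law by (rule prob_space_law)
  show ?thesis
    using assms by (intro law.bounded_measurable_kernel_ops) (auto simp: block_kernel_reversible)
qed

lemma lipschitz_along_kernel_ops:
  assumes As: "\<forall>A\<in>set As. independent_block m A" and f: "bounded_measurable law f"
  shows "\<exists>L\<ge>0. lipschitz_along (\<Union>(set As)) L (kernel_ops (map block_kernel As) f)"
  using As
proof (induction As)
  case Nil
  have "lipschitz_along {} 0 f"
    unfolding lipschitz_along_def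
  proof (intro ballI impI)
    fix x y assume "x \<in> space (knot_space m)" "y \<in> space (knot_space m)" "\<forall>i\<in>{1..m} - {}. x i = y i"
    then have "x = y" unfolding space_knot_space by (intro PiE_ext) auto
    then show "\<bar>f x - f y\<bar> \<le> 0 * L2_set (state_diff x y) {1..m}" by simp
  qed
  then show ?case by auto
next
  case (Cons A As)
  define g where "g = kernel_ops (map block_kernel As) f"
  have g: "bounded_measurable law g"
    unfolding g_def using Cons.prems f by (intro kernel_ops_bounded_measurable) auto
  obtain B where g_le: "0 \<le> B" "\<And>x. x \<in> space law \<Longrightarrow> \<bar>g x\<bar> \<le> B"
    using bounded_measurableE[OF g] by blast
  obtain L where lipschitz: "0 \<le> L" "lipschitz_along (\<Union>(set As)) L g"
    using Cons by (auto simp: g_def)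
  have "lipschitz_along (\<Union>(set As) \<union> A) (L + B / cond_sd) (kernel_op (block_kernel A) g)"
    using Cons.prems g_le lipschitz bounded_measurable_measurable[OF g]
    by (intro lipschitz_along_block_kernel) (auto simp: measurable_law)
  moreover have "0 \<le> L + B / cond_sd" using lipschitz(1) g_le(1) cond_sd_pos by simp
  ultimately show ?case by (auto simp: g_def Un_commute)
qed

end

subsection \<open>Sweeps are contractions\<close>

context autoregressive_bridge
begin

definition has_modulus :: "((nat \<Rightarrow> real) \<Rightarrow> real) \<Rightarrow> ((nat \<Rightarrow> real) \<Rightarrow> real) \<Rightarrow> bool" where
  "has_modulus f p \<longleftrightarrow> (\<forall>x\<in>space (knot_space m). \<forall>y\<in>space (knot_space m). \<bar>f x - f y\<bar> \<le> p (state_diff x y))"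

lemma has_modulus_mono:
  assumes "has_modulus f p" "\<And>e. supported m e \<Longrightarrow> p e \<le> q e"
  shows "has_modulus f q"
  using assms supported_state_diff unfolding has_modulus_def by (meson order_trans)

lemma state_diff_block_map:
  assumes block: "independent_block m A"
  shows "state_diff (block_map A x z) (block_map A y z) = gs_update \<alpha> A (state_diff x y)"
proof
  fix i
  have "cond_mean x i - cond_mean y i = neighbour_weight \<alpha> * (state_diff x y (i - 1) + state_diff x y (Suc i))"
    by (simp add: cond_mean_def state_diff_def algebra_simps)
  then show "state_diff (block_map A x z) (block_map A y z) i = gs_update \<alpha> A (state_diff x y) i"
    using independent_block_subset[OF block]
    by (auto simp: gs_update_def block_map_def state_diff_def bridge_path_def)
qed

text \<open>Running the block update from two states with the same noise maps their difference through
  the deterministic Gauss--Seidel update.\<close>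

lemma has_modulus_block_kernel:
  assumes block: "independent_block m A" and f: "bounded_measurable law f"
    and modulus: "has_modulus f p"
  shows "has_modulus (kernel_op (block_kernel A) f) (\<lambda>e. p (gs_update \<alpha> A e))"
  unfolding has_modulus_def
proof (intro ballI)
  fix x y assume xy: "x \<in> space (knot_space m)" "y \<in> space (knot_space m)"
  interpret N: prob_space "noise A" by (rule prob_space_noise)
  have f_measurable: "f \<in> borel_measurable (knot_space m)"
    using bounded_measurable_measurable[OF f] by (simp add: measurable_law)
  have map_measurable: "block_map A v \<in> noise A \<rightarrow>\<^sub>M knot_space m"
    if "v \<in> space (knot_space m)" for v
    using measurable_compose[OF measurable_Pair1'[OF that] block_map_measurable] by simp
  have kernel_op_eq: "kernel_op (block_kernel A) f v = (\<integral>z. f (block_map A v z) \<partial>noise A)"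
    if "v \<in> space (knot_space m)" for v
    unfolding kernel_op_def block_kernel_eq_noise[OF block that]
    using map_measurable[OF that] f_measurable by (rule integral_distr)
  have int_map: "integrable (noise A) (\<lambda>z. f (block_map A v z))" if "v \<in> space (knot_space m)" for v
  proof -
    obtain B where "\<And>x. x \<in> space (knot_space m) \<Longrightarrow> \<bar>f x\<bar> \<le> B"
      using bounded_measurableE[OF f] by auto
    then show ?thesis
      using measurable_compose[OF map_measurable[OF that] f_measurable]
        measurable_space[OF map_measurable[OF that]]
      by (intro N.integrable_const_bound[where B=B]) auto
  qed
  have "\<bar>f (block_map A x z) - f (block_map A y z)\<bar> \<le> p (gs_update \<alpha> A (state_diff x y))"
    if "z \<in> space (noise A)" for z
    using modulus measurable_space[OF map_measurable[OF xy(1)] that]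
      measurable_space[OF map_measurable[OF xy(2)] that]
    unfolding has_modulus_def state_diff_block_map[OF block, of x z y, symmetric] by blast
  then have "(\<integral>z. \<bar>f (block_map A x z) - f (block_map A y z)\<bar> \<partial>noise A) \<le> p (gs_update \<alpha> A (state_diff x y))"
    using int_map[OF xy(1)] int_map[OF xy(2)] by (intro N.integral_le_const) auto
  moreover have "kernel_op (block_kernel A) f x - kernel_op (block_kernel A) f y
      = (\<integral>z. f (block_map A x z) - f (block_map A y z) \<partial>noise A)"
    using int_map[OF xy(1)] int_map[OF xy(2)]
    by (simp add: kernel_op_eq[OF xy(1)] kernel_op_eq[OF xy(2)])
  ultimately show "\<bar>kernel_op (block_kernel A) f x - kernel_op (block_kernel A) f y\<bar>
      \<le> p (gs_update \<alpha> A (state_diff x y))"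
    using integral_abs_bound[of "noise A" "\<lambda>z. f (block_map A x z) - f (block_map A y z)"]
    by linarith
qed

lemma has_modulus_kernel_ops:
  assumes "\<forall>A\<in>set As. independent_block m A" and f: "bounded_measurable law f"
    and modulus: "has_modulus f p"
  shows "has_modulus (kernel_ops (map block_kernel As) f) (\<lambda>e. p (fold (gs_update \<alpha>) As e))"
  using assms(1)
proof (induction As)
  case (Cons A As)
  then show ?case
    using has_modulus_block_kernel[OF _ kernel_ops_bounded_measurable[OF _ f] Cons.IH] by simp
qed (simp add: modulus)

lemma lipschitz_along_has_modulus:
  assumes "lipschitz_along {1..m} L f" "0 \<le> L"
  shows "has_modulus f (\<lambda>e. L * real m * sqrt (action \<alpha> m e))"
  unfolding has_modulus_def
proof (intro ballI)
  fix x y assume "x \<in> space (knot_space m)" "y \<in> space (knot_space m)"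
  then have "\<bar>f x - f y\<bar> \<le> L * L2_set (state_diff x y) {1..m}"
    using assms(1) by (simp add: lipschitz_along_def)
  also have "L2_set (state_diff x y) {1..m} \<le> sqrt ((real m)\<^sup>2 * action \<alpha> m (state_diff x y))"
    unfolding L2_set_def
    using sum_squares_le_action[OF \<alpha> supported_state_diff] by (rule real_sqrt_le_mono)
  finally show "\<bar>f x - f y\<bar> \<le> L * real m * sqrt (action \<alpha> m (state_diff x y))"
    using assms(2) by (simp add: real_sqrt_mult mult_left_mono mult.assoc)
qed

lemma second_moment_le_modulus:
  assumes h: "bounded_measurable law h" and centred: "(\<integral>x. h x \<partial>law) = 0"
    and modulus: "has_modulus h (\<lambda>e. c * sqrt (action \<alpha> m e))"
  shows "(\<integral>x. (h x)\<^sup>2 \<partial>law) \<le> c\<^sup>2 * (4 * (\<integral>x. (\<Sum>i=1..m. (x i)\<^sup>2) \<partial>law))"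
proof -
  interpret law: prob_space law by (rule prob_space_law)
  define origin :: "nat \<Rightarrow> real" where "origin = (\<lambda>i\<in>{1..m}. 0)"
  have origin: "origin \<in> space (knot_space m)" by (auto simp: origin_def space_knot_space)
  note bounded_measurable_arith(3)[OF h bounded_measurable_const, of "h origin"]
  from this[THEN law.bounded_measurable_square_integrable]
  have int_square: "integrable law (\<lambda>x. (h x - h origin)\<^sup>2)" by (simp add: square_integrable_def)
  have "(\<integral>x. (h x)\<^sup>2 \<partial>law) \<le> (\<integral>x. (h x - h origin)\<^sup>2 \<partial>law)"
    using centred
      law.variance_le_second_moment[OF law.bounded_measurable_square_integrable[OF h], of "h origin"]
    by simp
  also have "\<dots> \<le> (\<integral>x. c\<^sup>2 * (4 * (\<Sum>i=1..m. (x i)\<^sup>2)) \<partial>law)"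
  proof (rule integral_mono[OF int_square])
    show "integrable law (\<lambda>x. c\<^sup>2 * (4 * (\<Sum>i=1..m. (x i)\<^sup>2)))" using law_second_moment by simp
    fix x assume "x \<in> space law"
    then have "\<bar>h x - h origin\<bar> \<le> c * sqrt (action \<alpha> m (state_diff x origin))"
      using modulus origin by (simp add: has_modulus_def)
    then have "\<bar>h x - h origin\<bar>\<^sup>2 \<le> (c * sqrt (action \<alpha> m (state_diff x origin)))\<^sup>2"
      by (intro power_mono) auto
    also have "\<dots> = c\<^sup>2 * action \<alpha> m (state_diff x origin)"
      by (simp add: power_mult_distrib action_nonneg)
    also have "\<dots> \<le> c\<^sup>2 * (4 * (\<Sum>i=1..m. (state_diff x origin i)\<^sup>2))"
      by (intro mult_left_mono action_le_sum_squares \<alpha> supported_state_diff) simp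
    also have "(\<Sum>i=1..m. (state_diff x origin i)\<^sup>2) = (\<Sum>i=1..m. (x i)\<^sup>2)"
      by (intro sum.cong refl) (simp add: state_diff_def bridge_path_def origin_def)
    finally show "(h x - h origin)\<^sup>2 \<le> c\<^sup>2 * (4 * (\<Sum>i=1..m. (x i)\<^sup>2))" by simp
  qed
  also have "\<dots> = c\<^sup>2 * (4 * (\<integral>x. (\<Sum>i=1..m. (x i)\<^sup>2) \<partial>law))" by simp
  finally show ?thesis .
qed

lemma gibbs_sweep_stationary:
  assumes "\<forall>A\<in>set As. independent_block m A"
  shows "stationary_kernel law (gibbs_sweep m dens As)"
  using assms
proof (induction As)
  case Nil
  have "gibbs_sweep m dens [] = return law" by (rule ext) (simp, rule return_cong, simp)
  then show ?case using stationary_kernel_return[OF prob_space_law] by simp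
next
  case (Cons A As)
  have "gibbs_sweep m dens (A # As) = (\<lambda>x. block_kernel A x \<bind> gibbs_sweep m dens As)"
    by (rule ext) simp
  moreover have "stationary_kernel law (block_kernel A)"
    using Cons.prems
    by (intro reversible_kernel_stationary block_kernel_reversible prob_space_law) simp
  ultimately show ?case using Cons stationary_kernel_bind by simp
qed

lemma kernel_op_gibbs_sweep:
  assumes "\<forall>A\<in>set As. independent_block m A" and f: "bounded_measurable law f" and "x \<in> space law"
  shows "kernel_op (gibbs_sweep m dens As) f x = kernel_ops (map block_kernel As) f x"
  using assms(1,3)
proof (induction As arbitrary: x)
  case Nil
  then show ?case
    using bounded_measurable_measurable[OF f]
    by (simp add: kernel_op_def integral_return measurable_law)
next
  case (Cons A As)
  have block: "independent_block m A" using Cons.prems by simp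
  note space = markov_kernelD(3)[OF block_kernel_measurable[OF block] Cons.prems(2)]
  have "gibbs_sweep m dens As \<in> law \<rightarrow>\<^sub>M prob_algebra law"
    using gibbs_sweep_stationary Cons.prems
    by (simp add: stationary_kernel_def stationary_kernel_axioms_def)
  then have "kernel_op (\<lambda>x. block_kernel A x \<bind> gibbs_sweep m dens As) f x
      = kernel_op (block_kernel A) (kernel_op (gibbs_sweep m dens As) f) x"
    using block_kernel_measurable[OF block] f Cons.prems(2) by (intro kernel_op_bind)
  also have "\<dots> = kernel_op (block_kernel A) (kernel_ops (map block_kernel As) f) x"
    unfolding kernel_op_def[of "block_kernel A"] using Cons space
    by (intro Bochner_Integration.integral_cong refl) simp
  finally show ?case by (simp add: kernel_op_def)
qed

end

locale autoregressive_bridge_sweep = autoregressive_bridge +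
  fixes As :: "nat set list"
  assumes partition: "block_partition m As"
begin

definition rate :: real where
  "rate = 1 - 1 / (8 * (real m)\<^sup>2)"

definition symmetrised :: "((nat \<Rightarrow> real) \<Rightarrow> real) \<Rightarrow> (nat \<Rightarrow> real) \<Rightarrow> real" where
  "symmetrised = kernel_ops (map block_kernel (rev As @ As))"

lemma rate_pos: "0 < rate"
proof -
  have "1 \<le> (real m)\<^sup>2" using m by simp
  then have "1 / (8 * (real m)\<^sup>2) < 1" by (subst divide_less_eq_1_pos) linarith+
  then show ?thesis by (simp add: rate_def)
qed

lemma independent_blocks: "\<forall>A\<in>set As. independent_block m A" "\<forall>A\<in>set (rev As @ As). independent_block m A"
  using partition by (auto simp: block_partition_def)

lemma action_symmetrised_sweep_le:
  assumes e: "supported m e"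
  shows "action \<alpha> m (fold (gs_update \<alpha>) (rev As @ As) e) \<le> rate\<^sup>2 * action \<alpha> m e"
proof -
  let ?e = "fold (gs_update \<alpha>) (rev As) e"
  have "action \<alpha> m (fold (gs_update \<alpha>) As ?e) \<le> rate * action \<alpha> m ?e"
    unfolding rate_def using partition \<alpha> m supported_gs_sweep[OF e, of "rev As"] independent_blocks
    by (intro action_gs_sweep_le) auto
  also have "\<dots> \<le> rate * (rate * action \<alpha> m e)"
    using rate_pos action_gs_sweep_le[OF block_partition_rev[OF partition] \<alpha> m e]
    by (intro mult_left_mono) (auto simp: rate_def)
  finally show ?thesis by (simp add: power2_eq_square)
qed

lemma symmetrised_bounded_measurable: "bounded_measurable law f \<Longrightarrow> bounded_measurable law (symmetrised f)"
  unfolding symmetrised_def using independent_blocks(2) by (rule kernel_ops_bounded_measurable)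

lemma symmetrised_iterates_bounded_measurable:
  "bounded_measurable law f \<Longrightarrow> bounded_measurable law ((symmetrised ^^ j) f)"
  by (induction j) (auto intro: symmetrised_bounded_measurable)

lemma symmetrised_iterates_centred:
  assumes f: "bounded_measurable law f" and centred: "(\<integral>x. f x \<partial>law) = 0"
  shows "(\<integral>x. (symmetrised ^^ j) f x \<partial>law) = 0"
proof (induction j)
  case (Suc j)
  interpret law: prob_space law by (rule prob_space_law)
  have "\<forall>K\<in>set (map block_kernel (rev As @ As)). reversible_kernel law K"
    using independent_blocks(2) block_kernel_reversible by auto
  from law.expectation_kernel_ops[OF this symmetrised_iterates_bounded_measurable[OF f, of j]]
  show ?case using Suc.IH by (simp add: symmetrised_def)
qed (simp add: centred)

lemma symmetrised_has_modulus:
  assumes "bounded_measurable law f"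
  obtains c where "0 \<le> c" "has_modulus (symmetrised f) (\<lambda>e. c * sqrt (action \<alpha> m e))"
proof -
  obtain L where lipschitz: "0 \<le> L" "lipschitz_along (\<Union>(set (rev As @ As))) L (symmetrised f)"
    unfolding symmetrised_def
    using lipschitz_along_kernel_ops[OF independent_blocks(2) assms] by blast
  moreover have "\<Union>(set (rev As @ As)) = {1..m}" using partition by (simp add: block_partition_def)
  ultimately have "has_modulus (symmetrised f) (\<lambda>e. L * real m * sqrt (action \<alpha> m e))"
    by (intro lipschitz_along_has_modulus) simp_all
  then show ?thesis using lipschitz(1) by (intro that[of "L * real m"]) auto
qed

lemma symmetrised_iterates_has_modulus:
  assumes f: "bounded_measurable law f" and c_nonneg: "0 \<le> c"
    and modulus: "has_modulus f (\<lambda>e. c * sqrt (action \<alpha> m e))"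
  shows "has_modulus ((symmetrised ^^ j) f) (\<lambda>e. c * rate ^ j * sqrt (action \<alpha> m e))"
proof (induction j)
  case (Suc j)
  have "has_modulus (symmetrised ((symmetrised ^^ j) f))
      (\<lambda>e. c * rate ^ j * sqrt (action \<alpha> m (fold (gs_update \<alpha>) (rev As @ As) e)))"
    using has_modulus_kernel_ops[OF independent_blocks(2) symmetrised_iterates_bounded_measurable[OF f] Suc.IH]
    unfolding symmetrised_def[symmetric] .
  then have "has_modulus (symmetrised ((symmetrised ^^ j) f)) (\<lambda>e. c * rate ^ Suc j * sqrt (action \<alpha> m e))"
  proof (rule has_modulus_mono)
    fix e assume "supported m e"
    then have "sqrt (action \<alpha> m (fold (gs_update \<alpha>) (rev As @ As) e)) \<le> sqrt (rate\<^sup>2 * action \<alpha> m e)"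
      by (intro real_sqrt_le_mono action_symmetrised_sweep_le)
    also have "\<dots> = rate * sqrt (action \<alpha> m e)" using rate_pos by (simp add: real_sqrt_mult)
    finally have "c * rate ^ j * sqrt (action \<alpha> m (fold (gs_update \<alpha>) (rev As @ As) e))
        \<le> c * rate ^ j * (rate * sqrt (action \<alpha> m e))"
      using c_nonneg rate_pos by (intro mult_left_mono) auto
    then show "c * rate ^ j * sqrt (action \<alpha> m (fold (gs_update \<alpha>) (rev As @ As) e))
        \<le> c * rate ^ Suc j * sqrt (action \<alpha> m e)" by (simp add: mult_ac)
  qed
  then show ?case by simp
qed (simp add: modulus)

lemma symmetrised_iterates_decay:
  assumes f: "bounded_measurable law f" and centred: "(\<integral>x. f x \<partial>law) = 0"
  obtains C where "\<And>j. (\<integral>x. ((symmetrised ^^ Suc j) f x)\<^sup>2 \<partial>law) \<le> C * (rate\<^sup>2) ^ j"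
proof -
  obtain c where modulus: "0 \<le> c" "has_modulus (symmetrised f) (\<lambda>e. c * sqrt (action \<alpha> m e))"
    using symmetrised_has_modulus[OF f] by blast
  define C where "C = c\<^sup>2 * (4 * (\<integral>x. (\<Sum>i=1..m. (x i)\<^sup>2) \<partial>law))"
  have "(\<integral>x. ((symmetrised ^^ Suc j) f x)\<^sup>2 \<partial>law) \<le> C * (rate\<^sup>2) ^ j" for j
  proof -
    have "has_modulus ((symmetrised ^^ Suc j) f) (\<lambda>e. c * rate ^ j * sqrt (action \<alpha> m e))"
      using symmetrised_iterates_has_modulus[OF symmetrised_bounded_measurable[OF f] modulus, of j]
      by (simp add: funpow_swap1)
    then have "(\<integral>x. ((symmetrised ^^ Suc j) f x)\<^sup>2 \<partial>law)
        \<le> (c * rate ^ j)\<^sup>2 * (4 * (\<integral>x. (\<Sum>i=1..m. (x i)\<^sup>2) \<partial>law))"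
      by (intro second_moment_le_modulus symmetrised_iterates_bounded_measurable
        symmetrised_iterates_centred f centred)
    then show ?thesis by (simp add: C_def power_mult_distrib power_mult[symmetric] mult_ac)
  qed
  then show ?thesis by (rule that)
qed

theorem sweep_l2_rate_ok: "l2_rate_ok law (gibbs_sweep m dens As) rate"
proof -
  let ?K = "gibbs_sweep m dens As"
  interpret stationary_kernel law ?K using independent_blocks(1) by (rule gibbs_sweep_stationary)
  have contraction: "variance (kernel_op ?K g) \<le> rate * variance g"
    if g: "bounded_measurable law g" for g
  proof -
    define a where "a = expectation g"
    define f where "f x = g x - a" for x
    have f: "bounded_measurable law f"
      unfolding f_def by (intro bounded_measurable_arith bounded_measurable_const g)
    have "expectation f = 0"
      using integrable_bounded_measurable[OF g] prob_space
      by (simp add: f_def[abs_def] a_def del: space_law)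
    then obtain C where decay: "\<And>j. expectation (\<lambda>x. ((symmetrised ^^ Suc j) f x)\<^sup>2) \<le> C * (rate\<^sup>2) ^ j"
      using symmetrised_iterates_decay[OF f] by blast
    have "kernel_op ?K g x - a = kernel_ops (map block_kernel As) f x" if x: "x \<in> space law" for x
      using kernel_op_add_const[OF kernel g x, of "- a"] kernel_op_gibbs_sweep[OF independent_blocks(1) f x]
      by (simp add: f_def[abs_def])
    then have "variance (kernel_op ?K g) = expectation (\<lambda>x. (kernel_ops (map block_kernel As) f x)\<^sup>2)"
      unfolding expectation_kernel_op[OF integrable_bounded_measurable[OF g]] a_def[symmetric]
      by (intro Bochner_Integration.integral_cong refl) simp
    also have "\<dots> \<le> rate * expectation (\<lambda>x. (f x)\<^sup>2)"
      using independent_blocks(1) block_kernel_reversible f rate_pos decay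
      by (intro kernel_ops_contraction[where C=C]) (auto simp: symmetrised_def rev_map)
    finally show ?thesis by (simp add: f_def a_def)
  qed
  show ?thesis
    using less_imp_le[OF rate_pos] variance_contraction_square_integrable[OF contraction]
    by (rule l2_rate_ok_variance_contraction)
qed

end

subsection \<open>The cost of blocking\<close>

definition autoregressive :: "(real \<Rightarrow> real \<Rightarrow> real \<Rightarrow> real) \<Rightarrow> bool" where
  "autoregressive p \<longleftrightarrow> (\<forall>t>0. \<exists>\<alpha> \<tau>. \<bar>\<alpha>\<bar> \<le> 1 \<and> 0 < \<tau> \<and> (\<forall>a b. p t a b = normal_density (\<alpha> * a) \<tau> b))"

abbreviation knot_count :: "real \<Rightarrow> real \<Rightarrow> real \<Rightarrow> nat" where
  "knot_count c \<eta> T \<equiv> nat \<lceil>c * T powr (1 + \<eta>)\<rceil>"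

abbreviation block_span :: "real \<Rightarrow> real \<Rightarrow> real \<Rightarrow> real" where
  "block_span c \<eta> T \<equiv> 2 * T / (real (knot_count c \<eta> T) + 1)"

lemma autoregressive_bm_trans:
  assumes "0 < \<sigma>"
  shows "autoregressive (bm_trans \<sigma>)"
  unfolding autoregressive_def
proof (intro allI impI)
  fix t :: real assume "0 < t"
  then have "\<bar>1::real\<bar> \<le> 1 \<and> 0 < \<sigma> * sqrt t \<and> (\<forall>a b. bm_trans \<sigma> t a b = normal_density (1 * a) (\<sigma> * sqrt t) b)"
    using assms by (simp add: bm_trans_def)
  then show "\<exists>\<alpha> \<tau>. \<bar>\<alpha>\<bar> \<le> 1 \<and> 0 < \<tau> \<and> (\<forall>a b. bm_trans \<sigma> t a b = normal_density (\<alpha> * a) \<tau> b)" by blast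
qed

lemma autoregressive_ou_trans:
  assumes \<sigma>: "0 < \<sigma>" and \<theta>: "0 < \<theta>"
  shows "autoregressive (ou_trans \<theta> \<sigma>)"
  unfolding autoregressive_def
proof (intro allI impI)
  fix t :: real assume t: "0 < t"
  define \<alpha> \<tau> where "\<alpha> = exp (- \<theta> * t)" and "\<tau> = \<sigma> * sqrt ((1 - exp (- 2 * \<theta> * t)) / (2 * \<theta>))"
  have "\<bar>\<alpha>\<bar> \<le> 1" "0 < \<tau>" using \<sigma> \<theta> t by (simp_all add: \<alpha>_def \<tau>_def)
  moreover have "ou_trans \<theta> \<sigma> t a b = normal_density (\<alpha> * a) \<tau> b" for a b
    by (simp add: ou_trans_def \<alpha>_def \<tau>_def mult.commute)
  ultimately show "\<exists>\<alpha> \<tau>. \<bar>\<alpha>\<bar> \<le> 1 \<and> 0 < \<tau> \<and> (\<forall>a b. ou_trans \<theta> \<sigma> t a b = normal_density (\<alpha> * a) \<tau> b)"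
    by blast
qed

lemma block_partition_checkerboard: "block_partition m (checkerboard_blocks m)"
  by (auto simp: block_partition_def independent_block_def checkerboard_blocks_def disjnt_iff)

lemma block_partition_lexicographic: "block_partition m (lexicographic_blocks m)"
proof -
  have "sorted_wrt disjnt (lexicographic_blocks m)"
    unfolding lexicographic_blocks_def sorted_wrt_map
    by (rule sorted_wrt_mono_rel[OF _ sorted_wrt_upt]) auto
  then show ?thesis
    by (auto simp: block_partition_def independent_block_def lexicographic_blocks_def)
qed

lemma gibbs_rate_bounds:
  assumes p: "autoregressive p" and T: "0 < T" and m: "1 \<le> m"
    and blocks: "block_partition m (blocks m)"
  shows "0 \<le> gibbs_rate p blocks x0 xT T m" "gibbs_rate p blocks x0 xT T m \<le> 1 - 1 / (8 * (real m)\<^sup>2)"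
proof -
  have "0 < knot_delta T m" using T by (simp add: knot_delta_def)
  then obtain \<alpha> \<tau> where step: "\<bar>\<alpha>\<bar> \<le> 1" "0 < \<tau>" "\<And>a b. p (knot_delta T m) a b = normal_density (\<alpha> * a) \<tau> b"
    using p unfolding autoregressive_def by blast
  interpret autoregressive_bridge_sweep \<alpha> \<tau> x0 xT m "blocks m" using step m blocks by unfold_locales
  have "bridge_dens p T m x0 xT x = dens x" for x
    unfolding bridge_dens_def dens_def Let_def
    by (intro prod.cong refl) (auto simp: bridge_path_def step(3))
  then have dens: "bridge_dens p T m x0 xT = dens" by (rule ext)
  have "gibbs_rate p blocks x0 xT T m = l2_rate law (gibbs_sweep m dens (blocks m))"
    by (simp add: gibbs_rate_def bridge_law_def dens law_def)
  then show "0 \<le> gibbs_rate p blocks x0 xT T m" "gibbs_rate p blocks x0 xT T m \<le> 1 - 1 / (8 * (real m)\<^sup>2)"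
    using l2_rate_bounds[OF sweep_l2_rate_ok] by (simp_all add: rate_def)
qed

text \<open>At \<open>\<rho> = 0\<close> the expression is \<open>0\<close>, because \<open>ln 0 = 0\<close> and \<open>x / 0 = 0\<close>.\<close>

lemma minus_inverse_ln_bounds:
  fixes \<rho> \<epsilon> :: real
  assumes "0 \<le> \<rho>" "\<rho> \<le> 1 - \<epsilon>" "0 < \<epsilon>"
  shows "0 \<le> - 1 / ln \<rho>" "- 1 / ln \<rho> \<le> 1 / \<epsilon>"
proof -
  have "0 \<le> - 1 / ln \<rho> \<and> - 1 / ln \<rho> \<le> 1 / \<epsilon>"
  proof (cases "\<rho> = 0")
    case True
    then show ?thesis using assms(3) by simp
  next
    case False
    then have "ln \<rho> \<le> \<rho> - 1" using assms(1) by (intro ln_le_minus_one) simp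
    then have le_minus_ln: "\<epsilon> \<le> - ln \<rho>" using assms(2) by linarith
    then have "1 / (- ln \<rho>) \<le> 1 / \<epsilon>" using assms(3) by (intro divide_left_mono mult_pos_pos) auto
    moreover have "0 \<le> 1 / (- ln \<rho>)" using le_minus_ln assms(3) by (intro divide_nonneg_nonneg) auto
    ultimately show ?thesis by simp
  qed
  then show "0 \<le> - 1 / ln \<rho>" "- 1 / ln \<rho> \<le> 1 / \<epsilon>" by simp_all
qed

lemma relax_time_bounds:
  assumes "autoregressive p" "0 < T" "1 \<le> m" "block_partition m (blocks m)"
  shows "0 \<le> relax_time p blocks x0 xT T m" "relax_time p blocks x0 xT T m \<le> 8 * (real m)\<^sup>2"
  using minus_inverse_ln_bounds[OF gibbs_rate_bounds[where blocks=blocks, OF assms, of x0 xT]] assms(3)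
  by (simp_all add: relax_time_def)

lemma abs_C_blocking_le:
  assumes setting: "autoregressive p" "0 < T" "1 \<le> m" "block_partition m (blocks m)"
    and K_nonneg: "0 \<le> K"
      and cost: "0 < C_rej (2 * T / (real m + 1))" "C_rej (2 * T / (real m + 1)) \<le> K * (2 * T / (real m + 1))"
  shows "\<bar>C_blocking C_rej p blocks x0 xT T m\<bar> \<le> 16 * K * T * (real m)\<^sup>2"
proof -
  define t where "t = 2 * T / (real m + 1)"
  note relax = relax_time_bounds[where blocks=blocks, OF setting, of x0 xT]
  have cost: "0 < C_rej t" "C_rej t \<le> K * t" using cost by (simp_all add: t_def)
  have "real m * C_rej t \<le> real m * (K * t)" using cost by (intro mult_left_mono) auto
  also have "\<dots> = 2 * K * T * (real m / (real m + 1))" by (simp add: t_def)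
  also have "\<dots> \<le> 2 * K * T * 1" using K_nonneg setting(2) by (intro mult_left_mono) auto
  finally have "real m * C_rej t \<le> 2 * K * T" by simp
  then have "relax_time p blocks x0 xT T m * (real m * C_rej t) \<le> (8 * (real m)\<^sup>2) * (2 * K * T)"
    using cost(1) by (intro mult_mono[OF relax(2)]) auto
  moreover have "\<bar>C_blocking C_rej p blocks x0 xT T m\<bar> = relax_time p blocks x0 xT T m * (real m * C_rej t)"
    using relax(1) cost(1) by (simp add: C_blocking_def t_def abs_mult)
  ultimately show ?thesis by (simp add: mult_ac)
qed

lemma knot_count_bounds:
  assumes "0 < c" "0 \<le> \<eta>" "1 \<le> T"
  shows "1 \<le> knot_count c \<eta> T" "c * T powr (1 + \<eta>) \<le> real (knot_count c \<eta> T)"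
    "real (knot_count c \<eta> T) \<le> (c + 1) * T powr (1 + \<eta>)"
proof -
  have "0 < c * T powr (1 + \<eta>)" using assms by simp
  then show "1 \<le> knot_count c \<eta> T" by linarith
  show "c * T powr (1 + \<eta>) \<le> real (knot_count c \<eta> T)" by (rule real_nat_ceiling_ge)
  have "1 \<le> T powr (1 + \<eta>)" using assms by (intro ge_one_powr_ge_zero) auto
  moreover have "real (knot_count c \<eta> T) \<le> c * T powr (1 + \<eta>) + 1"
    using \<open>0 < c * T powr (1 + \<eta>)\<close> by linarith
  ultimately show "real (knot_count c \<eta> T) \<le> (c + 1) * T powr (1 + \<eta>)" by (simp add: distrib_right)
qed

lemma block_span_pos: "0 < T \<Longrightarrow> 0 < block_span c \<eta> T"
  by (intro divide_pos_pos add_nonneg_pos) auto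

lemma eventually_block_span_le:
  assumes c_pos: "0 < c" and \<eta>: "0 < \<eta>" and t0_pos: "0 < t0"
  shows "eventually (\<lambda>T. block_span c \<eta> T \<le> t0) at_top"
proof -
  have "((\<lambda>T. 2 / c * T powr (- \<eta>)) \<longlongrightarrow> 2 / c * 0) at_top"
    using \<eta> by (intro tendsto_mult tendsto_const tendsto_neg_powr filterlim_ident) auto
  then have "eventually (\<lambda>T. 2 / c * T powr (- \<eta>) < t0) at_top"
    using t0_pos by (intro order_tendstoD) auto
  then show ?thesis using eventually_ge_at_top[of 1]
  proof eventually_elim
    case (elim T)
    have "0 < c * T powr (1 + \<eta>)" using c_pos elim by simp
    moreover have "c * T powr (1 + \<eta>) \<le> real (knot_count c \<eta> T) + 1"
      using knot_count_bounds(2)[OF c_pos less_imp_le[OF \<eta>] elim(2)] by linarith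
    ultimately have "block_span c \<eta> T \<le> 2 * T / (c * T powr (1 + \<eta>))"
      using elim by (intro frac_le) simp_all
    also have "\<dots> = 2 / c * T powr (- \<eta>)"
      using elim c_pos by (simp add: powr_add powr_minus field_simps)
    finally show ?case using elim by simp
  qed
qed

lemma C_blocking_bigo:
  assumes autoregressive: "autoregressive p"
    and blocks: "blocks \<in> {checkerboard_blocks, lexicographic_blocks}"
    and c_pos: "0 < c" and \<eta>: "0 \<le> \<eta>" and K_nonneg: "0 \<le> K" and C_pos: "\<forall>t>0. 0 < C_rej t"
    and C_le: "eventually (\<lambda>T. C_rej (block_span c \<eta> T) \<le> K * block_span c \<eta> T) at_top"
  shows "(\<lambda>T. C_blocking C_rej p blocks x0 xT T (knot_count c \<eta> T)) \<in> O[at_top](\<lambda>T. T powr (3 + 2 * \<eta>))"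
proof (rule bigoI)
  show "eventually (\<lambda>T. norm (C_blocking C_rej p blocks x0 xT T (knot_count c \<eta> T))
      \<le> (16 * K * (c + 1)\<^sup>2) * norm (T powr (3 + 2 * \<eta>))) at_top"
    using C_le eventually_ge_at_top[of 1]
  proof eventually_elim
    case (elim T)
    define n where "n = knot_count c \<eta> T"
    note n = knot_count_bounds[OF c_pos \<eta> elim(2), folded n_def]
    have "0 < C_rej (2 * T / (real n + 1))"
      using C_pos block_span_pos[of T c \<eta>] elim by (simp add: n_def)
    moreover have "block_partition n (blocks n)"
      using blocks block_partition_checkerboard block_partition_lexicographic by auto
    ultimately have "\<bar>C_blocking C_rej p blocks x0 xT T n\<bar> \<le> 16 * K * T * (real n)\<^sup>2"
      using autoregressive n(1) elim K_nonneg
      unfolding n_def[symmetric] by (intro abs_C_blocking_le) auto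
    also have "\<dots> \<le> 16 * K * T * ((c + 1) * T powr (1 + \<eta>))\<^sup>2"
      using n(3) K_nonneg elim by (intro mult_left_mono power_mono) auto
    also have "\<dots> = (16 * K * (c + 1)\<^sup>2) * (T powr 1 * (T powr (1 + \<eta>))\<^sup>2)"
      using elim by (simp add: power_mult_distrib)
    also have "T powr 1 * (T powr (1 + \<eta>))\<^sup>2 = T powr (3 + 2 * \<eta>)"
      unfolding power2_eq_square powr_add[symmetric] by (simp add: algebra_simps)
    finally show ?case by (simp add: n_def)
  qed
qed

theorem theorem1:
  fixes \<sigma> \<theta> x0 xT K t0 :: real and C_rej :: "real \<Rightarrow> real"
  assumes \<sigma>_pos: "\<sigma> > 0" and \<theta>_pos: "\<theta> > 0"
    and C_pos: "\<forall>t>0. C_rej t > 0"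
    and K_pos: "K > 0" and t0_pos: "t0 > 0"
    and C_small: "\<forall>t. 0 < t \<and> t \<le> t0 \<longrightarrow> C_rej t \<le> K * t"
  shows
    "(\<forall>blocks \<in> {checkerboard_blocks, lexicographic_blocks}.
       \<forall>c1>0. \<forall>\<chi>1>0.
         (\<lambda>T. C_blocking C_rej (ou_trans \<theta> \<sigma>) blocks x0 xT T (nat \<lceil>c1 * T powr (1 + \<chi>1)\<rceil>))
           \<in> O[at_top](\<lambda>T. T powr (3 + 2 * \<chi>1)))
     \<and> ((\<exists>c5>0. \<forall>t>0. C_rej t = c5 * t) \<longrightarrow>
        (\<forall>blocks \<in> {checkerboard_blocks, lexicographic_blocks}.
          \<forall>c1>0. \<forall>\<chi>1\<ge>0.
            (\<lambda>T. C_blocking C_rej (bm_trans \<sigma>) blocks x0 xT T (nat \<lceil>c1 * T powr (1 + \<chi>1)\<rceil>))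
              \<in> O[at_top](\<lambda>T. T powr (3 + 2 * \<chi>1))))"
proof (intro conjI impI ballI allI)
  fix blocks :: "nat \<Rightarrow> nat set list" and c1 \<chi>1 :: real
  assume blocks: "blocks \<in> {checkerboard_blocks, lexicographic_blocks}" and c1: "0 < c1"
    and \<chi>1: "0 < \<chi>1"
  have "eventually (\<lambda>T. C_rej (block_span c1 \<chi>1 T) \<le> K * block_span c1 \<chi>1 T) at_top"
    using eventually_block_span_le[OF c1 \<chi>1 t0_pos] eventually_gt_at_top[of 0]
    by eventually_elim (blast intro: C_small[rule_format] block_span_pos)
  then show "(\<lambda>T. C_blocking C_rej (ou_trans \<theta> \<sigma>) blocks x0 xT T (nat \<lceil>c1 * T powr (1 + \<chi>1)\<rceil>))
      \<in> O[at_top](\<lambda>T. T powr (3 + 2 * \<chi>1))"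
    by (rule C_blocking_bigo[OF autoregressive_ou_trans[OF \<sigma>_pos \<theta>_pos] blocks c1 less_imp_le[OF \<chi>1]
      less_imp_le[OF K_pos] C_pos])
next
  fix blocks :: "nat \<Rightarrow> nat set list" and c1 \<chi>1 :: real
  assume blocks: "blocks \<in> {checkerboard_blocks, lexicographic_blocks}" and c1: "0 < c1"
    and \<chi>1: "0 \<le> \<chi>1"
  assume "\<exists>c5>0. \<forall>t>0. C_rej t = c5 * t"
  then obtain c5 where c5: "0 < c5" "\<forall>t>0. C_rej t = c5 * t" by blast
  have "eventually (\<lambda>T. C_rej (block_span c1 \<chi>1 T) \<le> c5 * block_span c1 \<chi>1 T) at_top"
    using eventually_gt_at_top[of 0] by eventually_elim (use c5 block_span_pos in force)
  then show "(\<lambda>T. C_blocking C_rej (bm_trans \<sigma>) blocks x0 xT T (nat \<lceil>c1 * T powr (1 + \<chi>1)\<rceil>))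
      \<in> O[at_top](\<lambda>T. T powr (3 + 2 * \<chi>1))"
    by (rule C_blocking_bigo[OF autoregressive_bm_trans[OF \<sigma>_pos] blocks c1 \<chi>1 less_imp_le[OF c5(1)] C_pos])
qed

end
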